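(* Let $\{\varphi_n\}_{n=0}^\infty$ be a linearly dense stationary sequence of unit vectors in a Hilbert space $H$ with singular spectral measure $\mu$, with associated coefficient sequence $\{\alpha_n\}_{n\ge0}$. Let $\vec{x}\in H$, let $\{\epsilon_n\}_{n=0}^\infty\subset\mathbb{C}$, and let $\varepsilon(z)=\sum_{n=0}^\infty\epsilon_nz^n$. Suppose that at least one of the following conditions holds: (1) $\varepsilon\in H^\infty(\mathbb{D})$; (2) $M_\varepsilon\in L^\infty(\mu)$, where $M_\varepsilon(x)=\sup_{0\le r<1}|\varepsilon(re^{2\pi i x})|$; (3) for some $q>1$, $\displaystyle\sup_{0<r<1}\int_0^1|\varepsilon(re^{2\pi i x})|^{2q}\,d\mu(x)<\infty$. Then $$\lim_{r\to1^-}\Big\|\sum_{n=0}^\infty r^n\Big(\sum_{j=0}^n\alpha_{n-j}\epsilon_j\Big)\varphi_n\Big\|_H=0,$$ and consequently $$\lim_{r\to1^-}\sum_{n=0}^\infty r^n\Big(\sum_{j=0}^n\alpha_{n-j}\big(\langle\vec{x},\varphi_j\rangle+\epsilon_j\big)\Big)\varphi_n=\vec{x}$$ in the norm of $H$.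
   Context: $H$ is a complex Hilbert space with inner product linear in the first variable. A sequence $\{\varphi_n\}_{n=0}^\infty$ of unit vectors is stationary if $\langle\varphi_{n+k},\varphi_{m+k}\rangle=\langle\varphi_n,\varphi_m\rangle$ for all $n,m,k\in\mathbb{N}_0$. Its spectral measure is the Borel probability measure $\mu$ on $[0,1)$ with $\langle\varphi_n,\varphi_m\rangle=\int_0^1 e^{2\pi i(n-m)x}\,d\mu(x)$; it is singular if it is singular with respect to Lebesgue measure. Linearly dense means the linear span is dense in $H$. Let $\mu^+(z)=\int_0^1\frac{1}{1-ze^{-2\pi i x}}\,d\mu(x)$ for $z$ in the open unit disc $\mathbb{D}$, and $b(z)=1-\frac{1}{\mu^+(z)}$; for $\mu$ singular, $b$ is an inner function with $b(0)=0$. The sequence $\{\alpha_n\}$ is defined by $1-b(z)=\sum_{n=0}^\infty\alpha_n z^n$. $H^\infty(\mathbb{D})$ is the space of bounded holomorphic functions on $\mathbb{D}$. It is assumed that the power series $\varepsilon(z)$ has radius of convergence at least $1$. *)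

theory Defs
  imports "HOL-Complex_Analysis.Complex_Analysis" "HOL-Probability.Probability"
begin

text \<open>Complex Hilbert spaces, with inner product linear in the first variable. Norm, topology
  and completeness are those of the underlying real Banach space, whose scalar multiplication is
  the restriction of the complex one and whose norm is the one induced by the inner product;
  definiteness of the inner product follows from definiteness of the norm.\<close>

class complex_hilbert = banach +
  fixes scaleC :: "complex \<Rightarrow> 'a \<Rightarrow> 'a" (infixr "*\<^sub>C" 75)
    and cinner :: "'a \<Rightarrow> 'a \<Rightarrow> complex"
  assumes scaleC_add_right: "a *\<^sub>C (x + y) = a *\<^sub>C x + a *\<^sub>C y"
    and scaleC_add_left: "(a + b) *\<^sub>C x = a *\<^sub>C x + b *\<^sub>C x"
    and scaleC_scaleC: "a *\<^sub>C (b *\<^sub>C x) = (a * b) *\<^sub>C x"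
    and scaleR_scaleC: "scaleR r x = complex_of_real r *\<^sub>C x"
    and cinner_commute: "cinner x y = cnj (cinner y x)"
    and cinner_add_left: "cinner (x + y) z = cinner x z + cinner y z"
    and cinner_scaleC_left: "cinner (a *\<^sub>C x) y = a * cinner x y"
    and cinner_self: "cinner x x = complex_of_real ((norm x)\<^sup>2)"

global_interpretation complex_vector:
  vector_space "scaleC :: complex \<Rightarrow> 'a \<Rightarrow> 'a::complex_hilbert"
  defines cspan = complex_vector.span
proof
  show "1 *\<^sub>C x = x" for x :: 'a
    by (metis of_real_1 scaleR_one scaleR_scaleC)
qed (rule scaleC_add_right scaleC_add_left scaleC_scaleC)+

definition linearly_dense :: "(nat \<Rightarrow> 'a::complex_hilbert) \<Rightarrow> bool" where
  "linearly_dense \<phi> \<longleftrightarrow> closure (cspan (range \<phi>)) = UNIV"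

definition stationary :: "(nat \<Rightarrow> 'a::complex_hilbert) \<Rightarrow> bool" where
  "stationary \<phi> \<longleftrightarrow> (\<forall>n m k. cinner (\<phi> (n + k)) (\<phi> (m + k)) = cinner (\<phi> n) (\<phi> m))"

definition is_spectral_measure :: "(nat \<Rightarrow> 'a::complex_hilbert) \<Rightarrow> real measure \<Rightarrow> bool" where
  "is_spectral_measure \<phi> \<mu> \<longleftrightarrow>
     prob_space \<mu> \<and> sets \<mu> = sets (restrict_space borel {0..<1}) \<and>
     (\<forall>n m. cinner (\<phi> n) (\<phi> m) =
        (\<integral>x. exp (2 * of_real pi * \<i> * (of_nat n - of_nat m) * of_real x) \<partial>\<mu>))"

definition singular_wrt_lebesgue :: "real measure \<Rightarrow> bool" where
  "singular_wrt_lebesgue \<mu> \<longleftrightarrow>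
     (\<exists>N\<in>sets \<mu>. emeasure lborel N = 0 \<and> emeasure \<mu> (space \<mu> - N) = 0)"

definition mu_plus :: "real measure \<Rightarrow> complex \<Rightarrow> complex" where
  "mu_plus \<mu> z = (\<integral>x. 1 / (1 - z * exp (- (2 * of_real pi * \<i> * of_real x))) \<partial>\<mu>)"

definition inner_b :: "real measure \<Rightarrow> complex \<Rightarrow> complex" where
  "inner_b \<mu> z = 1 - 1 / mu_plus \<mu> z"

definition is_coeff_seq :: "real measure \<Rightarrow> (nat \<Rightarrow> complex) \<Rightarrow> bool" where
  "is_coeff_seq \<mu> \<alpha> \<longleftrightarrow> (\<forall>z\<in>ball 0 1. (\<lambda>n. \<alpha> n * z ^ n) sums (1 - inner_b \<mu> z))"

definition H_infinity :: "(complex \<Rightarrow> complex) set" where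
  "H_infinity = {f. f holomorphic_on ball 0 1 \<and> bounded (f ` ball 0 1)}"

definition power_series :: "(nat \<Rightarrow> complex) \<Rightarrow> complex \<Rightarrow> complex" where
  "power_series e z = (\<Sum>n. e n * z ^ n)"

definition circle_pt :: "real \<Rightarrow> real \<Rightarrow> complex" where
  "circle_pt r x = of_real r * exp (2 * of_real pi * \<i> * of_real x)"

text \<open>The supremum may be infinite, hence the values in \<^typ>\<open>ennreal\<close>.\<close>

definition radial_max :: "(nat \<Rightarrow> complex) \<Rightarrow> real \<Rightarrow> ennreal" where
  "radial_max e x = (SUP r\<in>{0..<1}. ennreal (norm (power_series e (circle_pt r x))))"

text \<open>Measurability is part of the condition: \<^const>\<open>esssup\<close> of a non-measurable function
  is \<^term>\<open>top\<close>.\<close>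

definition L_infinity :: "real measure \<Rightarrow> (real \<Rightarrow> ennreal) set" where
  "L_infinity \<mu> = {f. esssup \<mu> f < top}"

definition abel_term ::
  "(nat \<Rightarrow> complex) \<Rightarrow> (nat \<Rightarrow> 'a::complex_hilbert) \<Rightarrow> (nat \<Rightarrow> complex) \<Rightarrow> real \<Rightarrow> nat \<Rightarrow> 'a" where
  "abel_term \<alpha> \<phi> c r n = (of_real r ^ n * (\<Sum>j\<le>n. \<alpha> (n - j) * c j)) *\<^sub>C \<phi> n"

end

theory Submission
  imports Defs
begin

text \<open>
  Under the isometry \<open>\<phi>\<^sub>n \<mapsto> exp (2 \<pi> \<i> n x)\<close> into \<open>L\<^sup>2(\<mu>)\<close> the Abel sum of the perturbation is
  \<open>(1 - b) \<epsilon>\<close> on the circle of radius \<open>r\<close>. Everything therefore reduces to \<open>1 - b \<rightarrow> 0\<close> in \<open>L\<^sup>2(\<mu>)\<close>,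
  together with a domination argument, using \<open>\<bar>1 - b\<bar> \<le> 2\<close>. This convergence comes from Hilbert space
  geometry instead of boundary values: the partial sums \<open>S\<^sub>n\<close> of \<open>\<Sum> \<alpha>\<^sub>k \<phi>\<^sub>k\<close> arise from \<open>\<phi>\<^sub>0\<close> by
  projecting off \<open>\<phi>\<^sub>1, \<phi>\<^sub>2, \<dots>\<close> successively, so \<open>\<parallel>S\<^sub>n\<parallel>\<^sup>2\<close> is \<open>1\<close> minus the sum of \<open>\<bar>\<alpha>\<^sub>k\<bar>\<^sup>2\<close> over
  \<open>1 \<le> k \<le> n\<close>. Since \<open>b\<close> is inner, with coefficients \<open>-\<alpha>\<^sub>k\<close>, that sum tends to \<open>1\<close>;
  hence \<open>S\<^sub>n\<close> and its Abel means tend to \<open>0\<close>.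

  For the reconstruction of \<open>x\<close>, the Kaczmarz residuals decrease in norm, which bounds the Abel means
  by \<open>2 \<parallel>x\<parallel>\<close>, and by density only \<open>x = \<phi>\<^sub>m\<close> remains. In that case the coefficients
  \<open>\<langle>\<phi>\<^sub>m, \<phi>\<^sub>j\<rangle>\<close> with \<open>j \<ge> m\<close> reproduce \<open>\<phi>\<^sub>m\<close> exactly up to the factor \<open>r\<^sup>m\<close>, and the finitely
  many others form a bounded perturbation of the kind already treated.
\<close>

section \<open>Residuals and Abel means\<close>

lemma cinner_zero_left [simp]: "cinner 0 (y::'a::complex_hilbert) = 0"
  using cinner_add_left[of 0 0 y] by simp

lemma cinner_zero_right [simp]: "cinner (y::'a::complex_hilbert) 0 = 0"
  using cinner_commute[of y 0] by simp

lemma cinner_add_right: "cinner (z::'a::complex_hilbert) (x + y) = cinner z x + cinner z y"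
  by (metis cinner_add_left cinner_commute complex_cnj_add)

lemma cinner_scaleC_right: "cinner (x::'a::complex_hilbert) (a *\<^sub>C y) = cnj a * cinner x y"
  by (metis cinner_scaleC_left cinner_commute complex_cnj_mult)

lemma cinner_diff_left: "cinner (x - y) (z::'a::complex_hilbert) = cinner x z - cinner y z"
  using cinner_add_left[of "x - y" y z] by simp

lemma cinner_diff_right: "cinner (z::'a::complex_hilbert) (x - y) = cinner z x - cinner z y"
  using cinner_add_right[of z "x - y" y] by simp

lemma cinner_sum_left: "cinner (\<Sum>i\<in>A. f i) (z::'a::complex_hilbert) = (\<Sum>i\<in>A. cinner (f i) z)"
  by (induction A rule: infinite_finite_induct) (auto simp: cinner_add_left)

lemma cinner_sum_right: "cinner (z::'a::complex_hilbert) (\<Sum>i\<in>A. f i) = (\<Sum>i\<in>A. cinner z (f i))"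
  by (induction A rule: infinite_finite_induct) (auto simp: cinner_add_right)

lemma norm_scaleC [simp]: "norm (a *\<^sub>C (x::'a::complex_hilbert)) = norm a * norm x"
proof -
  have "complex_of_real ((norm (a *\<^sub>C x))\<^sup>2) = complex_of_real ((norm a * norm x)\<^sup>2)"
    unfolding cinner_self[symmetric] cinner_scaleC_left cinner_scaleC_right
    by (simp add: cinner_self power_mult_distrib complex_norm_square[symmetric] mult_ac)
  then have "(norm (a *\<^sub>C x))\<^sup>2 = (norm a * norm x)\<^sup>2"
    by (simp only: of_real_eq_iff)
  then show ?thesis
    by (simp add: power2_eq_iff_nonneg)
qed

lemma bounded_linear_scaleC: "bounded_linear (\<lambda>x::'a::complex_hilbert. a *\<^sub>C x)"
  by (rule bounded_linear_intro[where K = "norm a"])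
    (simp_all add: scaleC_add_right scaleR_scaleC scaleC_scaleC mult.commute)

text \<open>Pythagoras: the residual is orthogonal to the unit vector u, so removing the component
  along u lowers the squared norm by exactly its square.\<close>

lemma norm_projection_residual:
  fixes x u :: "'a::complex_hilbert"
  assumes "norm u = 1"
  shows "(norm (x - cinner x u *\<^sub>C u))\<^sup>2 = (norm x)\<^sup>2 - (norm (cinner x u))\<^sup>2"
proof -
  have "complex_of_real ((norm (x - cinner x u *\<^sub>C u))\<^sup>2)
      = complex_of_real ((norm x)\<^sup>2 - (norm (cinner x u))\<^sup>2)"
    unfolding cinner_self[symmetric] cinner_diff_left cinner_diff_right cinner_scaleC_left
      cinner_scaleC_right
    using cinner_self[of u] cinner_self[of x] cinner_commute[of u x] assms
    by (simp add: complex_norm_square[symmetric] mult.commute)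
  then show ?thesis by (simp only: of_real_eq_iff)
qed

lemma norm_cinner_unit_le:
  fixes x u :: "'a::complex_hilbert"
  assumes "norm u = 1"
  shows "norm (cinner x u) \<le> norm x"
  using norm_projection_residual[OF assms, of x]
  by (metis diff_ge_0_iff_ge norm_ge_zero power2_le_imp_le zero_le_power2)

lemma norm_sum_scaleC_sq:
  fixes \<phi> :: "nat \<Rightarrow> 'a::complex_hilbert"
  shows "complex_of_real ((norm (\<Sum>n\<in>A. c n *\<^sub>C \<phi> n))\<^sup>2)
       = (\<Sum>n\<in>A. \<Sum>m\<in>A. c n * cnj (c m) * cinner (\<phi> n) (\<phi> m))"
  unfolding cinner_self[symmetric] cinner_sum_left cinner_sum_right
  by (subst sum.swap) (simp add: cinner_scaleC_left cinner_scaleC_right mult_ac)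

text \<open>The Pythagorean identities telescope; the \<open>u n\<close> need not be mutually
  orthogonal. The identity serves twice: for the partial sums of the
  \<open>\<alpha> k *\<^sub>C \<phi> k\<close> and for the Kaczmarz residuals of a vector.\<close>

lemma residual_iteration_norm:
  fixes u :: "nat \<Rightarrow> 'a::complex_hilbert"
  assumes "\<And>n. norm (u n) = 1"
    and "\<And>n. Y (Suc n) = Y n - cinner (Y n) (u n) *\<^sub>C u n"
  shows "(norm (Y n))\<^sup>2 + (\<Sum>k<n. (norm (cinner (Y k) (u k)))\<^sup>2) = (norm (Y 0))\<^sup>2"
  by (induction n) (simp_all add: assms norm_projection_residual)

lemma summable_scaleC:
  fixes u :: "nat \<Rightarrow> 'a::complex_hilbert"
  assumes "summable (\<lambda>n. norm (c n))" and "\<And>n. norm (u n) = 1"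
  shows "summable (\<lambda>n. c n *\<^sub>C u n)"
  by (rule summable_norm_cancel) (simp add: assms)

section \<open>Abel means of bounded sequences\<close>

lemma summable_geometric_bounded:
  fixes X :: "nat \<Rightarrow> 'a::banach"
  assumes "\<And>n. norm (X n) \<le> B" "0 \<le> r" "r < 1"
  shows "summable (\<lambda>n. r ^ n *\<^sub>R X n)"
proof (rule summable_comparison_test')
  show "summable (\<lambda>n. B * r ^ n)"
    using assms by (intro summable_mult summable_geometric) auto
  show "norm (r ^ n *\<^sub>R X n) \<le> B * r ^ n" for n
    using mult_left_mono[OF assms(1), of "r ^ n" n] assms(2) by (simp add: mult.commute)
qed

text \<open>Summation by parts turns an Abel sum into an average of the partial sums with weights
  \<open>(1 - r) * r ^ n\<close>. Bounds on partial sums, which the projection arguments supply,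
  thereby carry over to Abel sums.\<close>

lemma abel_sum_by_parts:
  fixes f :: "nat \<Rightarrow> 'a::banach"
  assumes "\<And>n. norm (\<Sum>k\<le>n. f k) \<le> B" "0 \<le> r" "r < 1"
  shows "(\<lambda>n. r ^ n *\<^sub>R f n) sums ((1 - r) *\<^sub>R (\<Sum>n. r ^ n *\<^sub>R (\<Sum>k\<le>n. f k)))"
proof -
  define X where "X n = (\<Sum>k\<le>n. f k)" for n
  define s where "s = (\<Sum>n. r ^ n *\<^sub>R X n)"
  have s: "(\<lambda>n. r ^ n *\<^sub>R X n) sums s"
    unfolding s_def X_def by (intro summable_sums summable_geometric_bounded[OF assms])
  \<comment> \<open>\<open>Z\<close> is r times the series of the
    \<open>r ^ n *\<^sub>R X n\<close>, moved up by one index with 0 in front; subtracting it leaves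
    \<open>X n - X (n - 1) = f n\<close> in each term.\<close>
  define Z where "Z n = (case n of 0 \<Rightarrow> 0 | Suc k \<Rightarrow> r ^ n *\<^sub>R X k)" for n
  have "(\<lambda>n. r *\<^sub>R (r ^ n *\<^sub>R X n)) sums (r *\<^sub>R s)"
    by (rule sums_scaleR_right[OF s])
  then have "Z sums (r *\<^sub>R s)"
    using sums_Suc[of Z "r *\<^sub>R s"] by (simp add: Z_def)
  then have "(\<lambda>n. r ^ n *\<^sub>R X n - Z n) sums (s - r *\<^sub>R s)"
    by (rule sums_diff[OF s])
  moreover have "r ^ n *\<^sub>R X n - Z n = r ^ n *\<^sub>R f n" for n
    by (cases n) (auto simp: Z_def X_def algebra_simps)
  ultimately show ?thesis
    by (simp add: X_def s_def algebra_simps)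
qed

lemma abel_mean_norm_le:
  fixes X :: "nat \<Rightarrow> 'a::banach"
  assumes "\<And>n. norm (X n) \<le> s n" "\<And>n. s n \<le> B" "0 \<le> r" "r < 1"
  shows "norm ((1 - r) *\<^sub>R (\<Sum>n. r ^ n *\<^sub>R X n)) \<le> (1 - r) * (\<Sum>n. r ^ n * s n)"
proof -
  have s0: "0 \<le> s n" for n using assms(1)[of n] norm_ge_zero[of "X n"] by linarith
  have "summable (\<lambda>n. r ^ n *\<^sub>R s n)"
    using assms s0 by (intro summable_geometric_bounded[of s B]) auto
  then have "norm (\<Sum>n. r ^ n *\<^sub>R X n) \<le> (\<Sum>n. r ^ n * s n)"
    using assms by (intro norm_suminf_le) (auto intro: mult_left_mono)
  then show ?thesis using assms by (simp add: mult_left_mono)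
qed

lemma abel_mean_norm_bounded:
  fixes X :: "nat \<Rightarrow> 'a::banach"
  assumes "\<And>n. norm (X n) \<le> B" "0 \<le> r" "r < 1"
  shows "norm ((1 - r) *\<^sub>R (\<Sum>n. r ^ n *\<^sub>R X n)) \<le> B"
proof -
  have "norm ((1 - r) *\<^sub>R (\<Sum>n. r ^ n *\<^sub>R X n)) \<le> (1 - r) * (\<Sum>n. r ^ n * B)"
    by (rule abel_mean_norm_le[OF assms(1) order_refl assms(2,3)])
  also have "(\<Sum>n. r ^ n * B) = (1 / (1 - r)) * B"
    using assms by (subst suminf_mult2[symmetric]) (auto simp: suminf_geometric summable_geometric)
  finally show ?thesis using assms by simp
qed

lemma abel_mean_tendsto_0:
  fixes X :: "nat \<Rightarrow> 'a::banach"
  assumes lim: "X \<longlonglongrightarrow> 0" and bd: "\<And>n. norm (X n) \<le> B"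
  shows "((\<lambda>r. (1 - r) *\<^sub>R (\<Sum>n. r ^ n *\<^sub>R X n)) \<longlongrightarrow> 0) (at_left 1)"
proof (rule tendstoI)
  fix e :: real assume "e > 0"
  then obtain N where N: "\<And>n. n \<ge> N \<Longrightarrow> norm (X n) < e / 2"
    using LIMSEQ_D[OF lim, of "e / 2"] by auto
  \<comment> \<open>The finite head vanishes because of the factor \<open>1 - r\<close>. The tail is
    bounded by \<open>e / 2\<close>, and so are its averages, uniformly in r.\<close>
  define X1 where "X1 n = (if n < N then X n else 0)" for n
  define X2 where "X2 n = (if n < N then 0 else X n)" for n
  have B0: "B \<ge> 0" using bd[of 0] norm_ge_zero[of "X 0"] by linarith
  have bd1: "norm (X1 n) \<le> B" for n using bd B0 by (auto simp: X1_def)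
  have bd2: "norm (X2 n) \<le> e / 2" for n using N[of n] \<open>e > 0\<close> by (auto simp: X2_def)
  have fin: "(\<Sum>n. r ^ n *\<^sub>R X1 n) = (\<Sum>n<N. r ^ n *\<^sub>R X n)" for r :: real
    by (subst suminf_finite[of "{..<N}"]) (auto simp: X1_def)
  have "((\<lambda>r. (1 - r) *\<^sub>R (\<Sum>n<N. r ^ n *\<^sub>R X n)) \<longlongrightarrow> (1 - 1) *\<^sub>R (\<Sum>n<N. 1 ^ n *\<^sub>R X n)) (at_left 1)"
    by (intro tendsto_intros)
  then have "\<forall>\<^sub>F r in at_left 1. dist ((1 - r) *\<^sub>R (\<Sum>n<N. r ^ n *\<^sub>R X n)) 0 < e / 2"
    using \<open>e > 0\<close> by (intro tendstoD) auto
  moreover have "\<forall>\<^sub>F r in at_left (1::real). r \<in> {0<..<1}"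
    by (rule eventually_at_leftI[of 0]) auto
  ultimately show "\<forall>\<^sub>F r in at_left 1. dist ((1 - r) *\<^sub>R (\<Sum>n. r ^ n *\<^sub>R X n)) 0 < e"
  proof eventually_elim
    case (elim r)
    have "(\<Sum>n. r ^ n *\<^sub>R X n) = (\<Sum>n. r ^ n *\<^sub>R X1 n + r ^ n *\<^sub>R X2 n)"
      by (intro suminf_cong) (auto simp: X1_def X2_def)
    also have "\<dots> = (\<Sum>n. r ^ n *\<^sub>R X1 n) + (\<Sum>n. r ^ n *\<^sub>R X2 n)"
      using elim by (intro suminf_add[symmetric] summable_geometric_bounded[OF bd1]
          summable_geometric_bounded[OF bd2]) auto
    finally have eq: "(1 - r) *\<^sub>R (\<Sum>n. r ^ n *\<^sub>R X n) = (1 - r) *\<^sub>R (\<Sum>n<N. r ^ n *\<^sub>R X n)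
        + (1 - r) *\<^sub>R (\<Sum>n. r ^ n *\<^sub>R X2 n)"
      by (simp add: fin scaleR_add_right)
    have "norm ((1 - r) *\<^sub>R (\<Sum>n. r ^ n *\<^sub>R X2 n)) \<le> e / 2"
      using elim by (intro abel_mean_norm_bounded[OF bd2]) auto
    then show ?case
      using elim norm_triangle_ineq[of "(1 - r) *\<^sub>R (\<Sum>n<N. r ^ n *\<^sub>R X n)"
          "(1 - r) *\<^sub>R (\<Sum>n. r ^ n *\<^sub>R X2 n)"]
      unfolding eq by (simp only: dist_norm diff_zero)
  qed
qed

section \<open>Fourier series on the circle\<close>

text \<open>Absolute summability makes the partial sums uniformly bounded, so a constant dominates
  on a finite measure. The left side is kept as a Gram sum because the statement is used both for
  arc length, where the powers of w are orthonormal, and for \<mu>, where they have the Gram matrix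
  of the sequence \<phi>.\<close>

lemma parseval_limit:
  fixes w :: "'a \<Rightarrow> complex"
  assumes "finite_measure M" and w [measurable]: "w \<in> borel_measurable M"
    and norm_w: "\<And>t. norm (w t) = 1" and c: "summable (\<lambda>n. norm (c n))"
  shows "(\<lambda>N. \<Sum>n<N. \<Sum>m<N. c n * cnj (c m) * (\<integral>t. w t ^ n * cnj (w t) ^ m \<partial>M))
    \<longlonglongrightarrow> complex_of_real (\<integral>t. (norm (\<Sum>n. c n * w t ^ n))\<^sup>2 \<partial>M)"
proof -
  interpret finite_measure M by fact
  have [measurable]: "(\<lambda>t. cnj (w t)) \<in> borel_measurable M"
    by (rule borel_measurable_continuous_on[OF _ w]) (intro continuous_intros)
  define f where "f N t = (\<Sum>n<N. c n * w t ^ n)" for N t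
  define C where "C = (\<Sum>n. norm (c n))"
  have f_meas [measurable]: "f N \<in> borel_measurable M" for N
    unfolding f_def by measurable
  have f_le: "norm (f N t) \<le> C" for N t
  proof -
    have "norm (f N t) \<le> (\<Sum>n<N. norm (c n))"
      unfolding f_def by (rule order_trans[OF norm_sum]) (simp add: norm_mult norm_power norm_w)
    also have "\<dots> \<le> C"
      unfolding C_def by (rule sum_le_suminf[OF c]) auto
    finally show ?thesis .
  qed
  have int: "integrable M (\<lambda>t. w t ^ n * cnj (w t) ^ m)" for n m
    by (rule integrable_const_bound[where B = 1]) (auto simp: norm_mult norm_power norm_w)
  have "complex_of_real (\<integral>t. (norm (f N t))\<^sup>2 \<partial>M)
      = (\<Sum>n<N. \<Sum>m<N. c n * cnj (c m) * (\<integral>t. w t ^ n * cnj (w t) ^ m \<partial>M))" for N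
  proof -
    have "complex_of_real (\<integral>t. (norm (f N t))\<^sup>2 \<partial>M)
        = (\<integral>t. (\<Sum>n<N. \<Sum>m<N. c n * cnj (c m) * (w t ^ n * cnj (w t) ^ m)) \<partial>M)"
      unfolding integral_complex_of_real[symmetric] complex_norm_square f_def
      by (intro Bochner_Integration.integral_cong refl) (simp add: sum_product mult_ac)
    then show ?thesis
      using int by (simp add: integrable_mult_right)
  qed
  moreover have "(\<lambda>N. \<integral>t. (norm (f N t))\<^sup>2 \<partial>M) \<longlonglongrightarrow> (\<integral>t. (norm (\<Sum>n. c n * w t ^ n))\<^sup>2 \<partial>M)"
  proof (rule integral_dominated_convergence[where w = "\<lambda>_. C\<^sup>2"])
    show "AE t in M. (\<lambda>N. (norm (f N t))\<^sup>2) \<longlonglongrightarrow> (norm (\<Sum>n. c n * w t ^ n))\<^sup>2"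
    proof (intro AE_I2 tendsto_intros)
      fix t
      have "summable (\<lambda>n. c n * w t ^ n)"
        by (rule summable_norm_cancel) (simp add: norm_mult norm_power norm_w c)
      then show "(\<lambda>N. f N t) \<longlonglongrightarrow> (\<Sum>n. c n * w t ^ n)"
        unfolding f_def by (rule summable_LIMSEQ)
    qed
    show "AE t in M. norm ((norm (f N t))\<^sup>2) \<le> C\<^sup>2" for N
      using f_le by (auto intro!: power_mono)
  qed auto
  ultimately show ?thesis
    using tendsto_of_real by (metis (no_types, lifting) ext)
qed

text \<open>The Cauchy kernel is a geometric series in \<open>z * cnj (w t)\<close>, dominated by
  \<open>norm (h t) * norm z ^ n\<close>, so it may be integrated term by term.\<close>

lemma cauchy_transform_sums:
  fixes w h :: "'a \<Rightarrow> complex"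
  assumes w [measurable]: "w \<in> borel_measurable M" and norm_w: "\<And>t. norm (w t) = 1"
    and h: "integrable M h" and z: "norm z < 1"
  shows "(\<lambda>n. (\<integral>t. h t * cnj (w t) ^ n \<partial>M) * z ^ n) sums (\<integral>t. h t / (1 - z * cnj (w t)) \<partial>M)"
proof -
  have [measurable]: "(\<lambda>t. cnj (w t)) \<in> borel_measurable M"
    by (rule borel_measurable_continuous_on[OF _ w]) (intro continuous_intros)
  have [measurable]: "h \<in> borel_measurable M" using h by simp
  define f where "f n t = h t * cnj (w t) ^ n * z ^ n" for n t
  have nf: "norm (f n t) = norm (h t) * norm z ^ n" for n t
    by (simp add: f_def norm_mult norm_power norm_w)
  have sg: "summable (\<lambda>n. norm z ^ n)" using z by (intro summable_geometric) simp
  have int0: "integrable M (\<lambda>t. h t * cnj (w t) ^ n)" for n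
    by (rule Bochner_Integration.integrable_bound[OF h]) (auto simp: norm_mult norm_power norm_w)
  have int: "integrable M (f n)" for n
    unfolding f_def by (intro integrable_mult_left int0)
  have "(\<lambda>n. integral\<^sup>L M (f n)) sums (\<integral>t. (\<Sum>n. f n t) \<partial>M)"
    by (rule sums_integral[OF int]) (simp_all only: nf integral_mult_left_zero summable_mult summable_mult2 sg AE_I2)
  moreover have "(\<Sum>n. f n t) = h t / (1 - z * cnj (w t))" for t
  proof -
    have "norm (z * cnj (w t)) < 1" using z by (simp add: norm_mult norm_w)
    then have "(\<lambda>n. h t * (z * cnj (w t)) ^ n) sums (h t * (1 / (1 - z * cnj (w t))))"
      by (intro sums_mult geometric_sums)
    then show ?thesis
      by (auto simp: f_def power_mult_distrib mult_ac dest!: sums_unique[symmetric])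
  qed
  moreover have "integral\<^sup>L M (f n) = (\<integral>t. h t * cnj (w t) ^ n \<partial>M) * z ^ n" for n
    unfolding f_def by simp
  ultimately show ?thesis by simp
qed

text \<open>This is the real part of \<open>(1 + a) / (1 - a)\<close>. At
  \<open>a = z * cnj w\<close> with w on the unit circle it expresses the Poisson kernel through the
  Cauchy kernel.\<close>

lemma half_plane_kernel:
  assumes "a \<noteq> 1"
  shows "2 * Re (1 / (1 - a)) - 1 = (1 - (norm a)\<^sup>2) / (norm (1 - a))\<^sup>2"
proof -
  have n: "(norm (1 - a))\<^sup>2 \<noteq> 0" using assms by simp
  have "2 * Re (1 / (1 - a)) - 1 = (2 * (1 - Re a) - (norm (1 - a))\<^sup>2) / (norm (1 - a))\<^sup>2"
    using n by (simp add: Re_divide diff_divide_distrib cmod_power2 del: zero_eq_power2)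
  also have "2 * (1 - Re a) - (norm (1 - a))\<^sup>2 = 1 - (norm a)\<^sup>2"
    unfolding cmod_power2 by (simp add: power2_eq_square algebra_simps)
  finally show ?thesis .
qed

section \<open>Characters and normalised arc length on the circle\<close>

lemma circle_pt_eq: "circle_pt r x = of_real r * circle_pt 1 x"
  by (simp add: circle_pt_def)

lemma circle_pt_1: "circle_pt 1 x = cis (2 * pi * x)"
  by (simp add: circle_pt_def cis_conv_exp mult_ac)

lemma norm_circle_pt [simp]: "norm (circle_pt r x) = \<bar>r\<bar>"
  by (subst circle_pt_eq) (simp add: circle_pt_1 norm_mult)

lemma circle_pt_measurable: "circle_pt r \<in> borel_measurable borel"
  unfolding circle_pt_def by (intro borel_measurable_continuous_onI continuous_intros)

lemma circle_pt_inj: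
  assumes "x \<in> {0..<1}" "y \<in> {0..<1}" "circle_pt 1 x = circle_pt 1 y"
  shows "x = y"
proof -
  have "sin (2 * pi * x) = sin (2 * pi * y) \<and> cos (2 * pi * x) = cos (2 * pi * y)"
    using assms(3) by (auto simp: circle_pt_1 complex_eq_iff)
  then obtain n :: int where "2 * pi * x = 2 * pi * y + 2 * pi * n"
    unfolding sin_cos_eq_iff by blast
  then have "2 * pi * x = 2 * pi * (y + n)" by (simp add: algebra_simps)
  then have "x = y + n" by simp
  moreover from this have "n = 0" using assms(1,2) by auto
  ultimately show ?thesis by simp
qed

text \<open>Normalised arc length in the parameter of \<open>circle_pt\<close>. The closed interval
  matches the form of the fundamental theorem of calculus used below; the point of the circle that
  it counts twice is Lebesgue null.\<close>

definition arc_measure :: "real measure" where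
  "arc_measure = restrict_space lborel {0..1}"

lemma prob_space_arc_measure: "prob_space arc_measure"
  by (rule prob_spaceI) (simp add: arc_measure_def emeasure_restrict_space space_restrict_space)

lemma circle_pt_measurable_arc [measurable]: "circle_pt r \<in> borel_measurable arc_measure"
  unfolding arc_measure_def by (intro measurable_restrict_space1) (simp add: circle_pt_measurable)

lemma integral_arc_character:
  "(\<integral>t. circle_pt 1 t ^ n * cnj (circle_pt 1 t) ^ m \<partial>arc_measure) = (if n = m then 1 else 0)"
proof -
  define k where "k = real n - real m"
  have eq: "circle_pt 1 t ^ n * cnj (circle_pt 1 t) ^ m = cis (2 * pi * k * t)" for t
    by (simp add: circle_pt_1 cis_cnj Complex.DeMoivre cis_mult k_def algebra_simps)
  show ?thesis
  proof (cases "n = m")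
    case True
    then show ?thesis
      unfolding eq using prob_space.prob_space[OF prob_space_arc_measure] by (simp add: k_def)
  next
    case False
    then have k: "k \<noteq> 0" by (simp add: k_def)
    \<comment> \<open>An antiderivative of the character. It takes equal values at 0 and 1 since k
      is a nonzero integer.\<close>
    define F where "F t = cis (2 * pi * k * t) / (\<i> * of_real (2 * pi * k))" for t
    have "(F has_vector_derivative cis (2 * pi * k * t)) (at t within {0..1})" for t
      unfolding F_def cis_conv_exp using k
      by (auto intro!: derivative_eq_intros has_vector_derivative_real_field simp: field_simps)
    then have "integral\<^sup>L lborel (\<lambda>t. indicator {0..1} t *\<^sub>R cis (2 * pi * k * t)) = F 1 - F 0"
      by (intro integral_FTC_atLeastAtMost) (auto intro!: continuous_intros)
    also have "\<dots> = 0" by (simp add: F_def k_def)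
    finally show ?thesis
      using False unfolding eq arc_measure_def by (subst integral_restrict_space) auto
  qed
qed

lemma parseval_arc:
  assumes c: "summable (\<lambda>n. norm (c n))"
  shows "(\<lambda>n. (norm (c n))\<^sup>2) sums (\<integral>t. (norm (\<Sum>n. c n * circle_pt 1 t ^ n))\<^sup>2 \<partial>arc_measure)"
proof -
  interpret prob_space arc_measure by (rule prob_space_arc_measure)
  have "(\<Sum>n<N. \<Sum>m<N. c n * cnj (c m) * (if n = m then 1 else 0))
      = complex_of_real (\<Sum>n<N. (norm (c n))\<^sup>2)" for N
    by (simp add: complex_norm_square[symmetric] if_distrib[of "\<lambda>x. _ * x"] cong: if_cong)
  then show ?thesis
    using parseval_limit[OF finite_measure_axioms circle_pt_measurable_arc[of 1] _ c]
    by (simp only: integral_arc_character sums_def tendsto_of_real_iff norm_circle_pt abs_one)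
qed

text \<open>The mean value property: integrated term by term, every nonconstant character vanishes
  and only the constant coefficient survives.\<close>

lemma integral_arc_power_series:
  assumes c: "summable (\<lambda>n. norm (c n))"
  shows "(\<integral>t. (\<Sum>n. c n * circle_pt 1 t ^ n) \<partial>arc_measure) = c 0"
    and "integrable arc_measure (\<lambda>t. \<Sum>n. c n * circle_pt 1 t ^ n)"
proof -
  interpret prob_space arc_measure by (rule prob_space_arc_measure)
  have nt: "norm (c n * circle_pt 1 t ^ n) = norm (c n)" for n t
    by (simp add: norm_mult norm_power)
  have int: "integrable arc_measure (\<lambda>t. c n * circle_pt 1 t ^ n)" for n
    by (rule integrable_const_bound[where B = "norm (c n)"]) (auto simp: nt)
  have s: "summable (\<lambda>n. \<integral>t. norm (c n * circle_pt 1 t ^ n) \<partial>arc_measure)"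
    using c by (simp add: nt prob_space)
  show "integrable arc_measure (\<lambda>t. \<Sum>n. c n * circle_pt 1 t ^ n)"
    by (rule integrable_suminf[OF int _ s]) (simp add: nt c)
  have "(\<integral>t. (\<Sum>n. c n * circle_pt 1 t ^ n) \<partial>arc_measure)
      = (\<Sum>n. \<integral>t. c n * circle_pt 1 t ^ n \<partial>arc_measure)"
    by (rule integral_suminf[OF int _ s]) (simp add: nt c)
  also have "\<dots> = (\<Sum>n. if n = 0 then c 0 else 0)"
  proof (rule suminf_cong)
    show "(\<integral>t. c n * circle_pt 1 t ^ n \<partial>arc_measure) = (if n = 0 then c 0 else 0)" for n
      using integral_arc_character[of n 0] by simp
  qed
  finally show "(\<integral>t. (\<Sum>n. c n * circle_pt 1 t ^ n) \<partial>arc_measure) = c 0"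
    by (subst (asm) suminf_finite[of "{0}"]) auto
qed

section \<open>Poisson and Cauchy integrals of a measure on the circle\<close>

text \<open>The Poisson integral at z of the measure with density h relative to M, carried to the
  circle. Indicator functions as h allow M to be split into parts.\<close>

definition poisson :: "real measure \<Rightarrow> (real \<Rightarrow> real) \<Rightarrow> complex \<Rightarrow> real" where
  "poisson M h z = (\<integral>t. h t * ((1 - (norm z)\<^sup>2) / (norm (1 - z * cnj (circle_pt 1 t)))\<^sup>2) \<partial>M)"

locale circle_measure = prob_space \<mu> for \<mu> :: "real measure" +
  assumes sets_eq: "sets \<mu> = sets (restrict_space borel {0..<1})"
begin

lemma space_eq: "space \<mu> = {0..<1}"
  using sets_eq_imp_space_eq[OF sets_eq] by (simp add: space_restrict_space)

lemma measurable_circle: "f \<in> borel_measurable borel \<Longrightarrow> f \<in> borel_measurable \<mu>"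
  unfolding measurable_cong_sets[OF sets_eq refl] by (rule measurable_restrict_space1)

lemma circle_pt_measurable_\<mu> [measurable]: "circle_pt r \<in> borel_measurable \<mu>"
  by (intro measurable_circle circle_pt_measurable)

lemma cnj_circle_pt_measurable [measurable]: "(\<lambda>t. cnj (circle_pt 1 t)) \<in> borel_measurable \<mu>"
  by (rule borel_measurable_continuous_on[OF _ circle_pt_measurable_\<mu>]) (intro continuous_intros)

lemma norm_cauchy_denominator_ge: "norm (1 - z * cnj (circle_pt 1 t)) \<ge> 1 - norm z"
  using norm_triangle_ineq2[of 1 "z * cnj (circle_pt 1 t)"] by (simp add: norm_mult)

lemma integrable_cauchy_kernel:
  fixes h :: "real \<Rightarrow> real"
  assumes h: "integrable \<mu> h" and z: "norm z < 1"
  shows "integrable \<mu> (\<lambda>t. complex_of_real (h t) / (1 - z * cnj (circle_pt 1 t)))"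
proof (rule Bochner_Integration.integrable_bound)
  have [measurable]: "h \<in> borel_measurable \<mu>" using h by simp
  show "integrable \<mu> (\<lambda>t. h t / (1 - norm z))" using h by simp
  show "(\<lambda>t. complex_of_real (h t) / (1 - z * cnj (circle_pt 1 t))) \<in> borel_measurable \<mu>"
    by measurable
  show "AE t in \<mu>. norm (complex_of_real (h t) / (1 - z * cnj (circle_pt 1 t)))
      \<le> norm (h t / (1 - norm z))"
    using z norm_cauchy_denominator_ge[of z]
    by (intro AE_I2) (auto simp: norm_divide intro!: divide_left_mono mult_pos_pos
        intro: less_le_trans[of 0 "1 - norm z"])
qed

text \<open>\<open>half_plane_kernel\<close>, integrated against h. The Poisson integral thus
  inherits integrability and a power series expansion from the Cauchy transform.\<close>

lemma
  fixes h :: "real \<Rightarrow> real"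
  assumes h: "integrable \<mu> h" and z: "norm z < 1"
  shows poisson_eq: "poisson \<mu> h z
      = 2 * Re (\<integral>t. complex_of_real (h t) / (1 - z * cnj (circle_pt 1 t)) \<partial>\<mu>) - (\<integral>t. h t \<partial>\<mu>)"
    and integrable_poisson: "integrable \<mu>
      (\<lambda>t. h t * ((1 - (norm z)\<^sup>2) / (norm (1 - z * cnj (circle_pt 1 t)))\<^sup>2))"
proof -
  let ?k = "\<lambda>t. complex_of_real (h t) / (1 - z * cnj (circle_pt 1 t))"
  have k: "integrable \<mu> ?k" by (rule integrable_cauchy_kernel[OF h z])
  have eq: "h t * ((1 - (norm z)\<^sup>2) / (norm (1 - z * cnj (circle_pt 1 t)))\<^sup>2) = 2 * Re (?k t) - h t"
    for t
  proof -
    have "norm (z * cnj (circle_pt 1 t)) = norm z" by (simp add: norm_mult)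
    moreover from this z have "z * cnj (circle_pt 1 t) \<noteq> 1" by auto
    ultimately have "(1 - (norm z)\<^sup>2) / (norm (1 - z * cnj (circle_pt 1 t)))\<^sup>2
        = 2 * Re (1 / (1 - z * cnj (circle_pt 1 t))) - 1"
      using half_plane_kernel[of "z * cnj (circle_pt 1 t)"] by simp
    moreover have "Re (?k t) = h t * Re (1 / (1 - z * cnj (circle_pt 1 t)))"
      by (simp add: Re_divide)
    ultimately show ?thesis by (simp only: right_diff_distrib mult.right_neutral mult.left_commute)
  qed
  show "integrable \<mu> (\<lambda>t. h t * ((1 - (norm z)\<^sup>2) / (norm (1 - z * cnj (circle_pt 1 t)))\<^sup>2))"
    unfolding eq using k h by (intro Bochner_Integration.integrable_diff integrable_mult_right integrable_Re)
  show "poisson \<mu> h z = 2 * Re (integral\<^sup>L \<mu> ?k) - (\<integral>t. h t \<partial>\<mu>)"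
    unfolding poisson_def eq using k h
    by (subst Bochner_Integration.integral_diff) (auto simp: integral_Re)
qed

lemma poisson_nonneg:
  assumes "norm z < 1" "\<And>t. h t \<ge> 0"
  shows "poisson \<mu> h z \<ge> 0"
  unfolding poisson_def using assms
  by (intro integral_nonneg_AE AE_I2 mult_nonneg_nonneg divide_nonneg_nonneg)
    (auto simp: power_le_one)

lemma poisson_add:
  assumes "integrable \<mu> h" "integrable \<mu> g" "norm z < 1"
  shows "poisson \<mu> (\<lambda>t. h t + g t) z = poisson \<mu> h z + poisson \<mu> g z"
  unfolding poisson_def distrib_right
  by (intro Bochner_Integration.integral_add integrable_poisson assms)

text \<open>Poisson integration preserves total mass. On the circle of radius r the Cauchy transform
  is an absolutely convergent Fourier series with constant term
  \<open>\<integral>t. h t \<partial>\<mu>\<close>; its mean enters twice and the mass is subtracted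
  once.\<close>

lemma
  fixes h :: "real \<Rightarrow> real"
  assumes h: "integrable \<mu> h" and r: "0 \<le> r" "r < 1"
  shows integral_poisson_arc: "(\<integral>x. poisson \<mu> h (circle_pt r x) \<partial>arc_measure) = (\<integral>t. h t \<partial>\<mu>)"
    and integrable_poisson_arc: "integrable arc_measure (\<lambda>x. poisson \<mu> h (circle_pt r x))"
proof -
  interpret arc: prob_space arc_measure by (rule prob_space_arc_measure)
  let ?h = "\<lambda>t. complex_of_real (h t)"
  define c where "c n = (\<integral>t. ?h t * cnj (circle_pt 1 t) ^ n \<partial>\<mu>) * of_real r ^ n" for n
  have "norm (c n) \<le> (\<integral>t. \<bar>h t\<bar> \<partial>\<mu>) * r ^ n" for n
  proof -
    have "norm (\<integral>t. ?h t * cnj (circle_pt 1 t) ^ n \<partial>\<mu>) \<le> (\<integral>t. norm (?h t * cnj (circle_pt 1 t) ^ n) \<partial>\<mu>)"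
      by (rule integral_norm_bound)
    then show ?thesis
      using r by (simp add: c_def norm_mult norm_power mult_right_mono)
  qed
  then have c: "summable (\<lambda>n. norm (c n))"
  proof (intro summable_comparison_test'[of "\<lambda>n. (\<integral>t. \<bar>h t\<bar> \<partial>\<mu>) * r ^ n" 0 "\<lambda>n. norm (c n)"])
    show "summable (\<lambda>n. (\<integral>t. \<bar>h t\<bar> \<partial>\<mu>) * r ^ n)"
      using r by (intro summable_mult summable_geometric) auto
  qed simp
  have eq: "poisson \<mu> h (circle_pt r x) = 2 * Re (\<Sum>n. c n * circle_pt 1 x ^ n) - (\<integral>t. h t \<partial>\<mu>)" for x
  proof -
    have z: "norm (circle_pt r x) < 1" using r by simp
    have "(\<lambda>n. (\<integral>t. ?h t * cnj (circle_pt 1 t) ^ n \<partial>\<mu>) * circle_pt r x ^ n) sums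
        (\<integral>t. ?h t / (1 - circle_pt r x * cnj (circle_pt 1 t)) \<partial>\<mu>)"
      using h z by (intro cauchy_transform_sums) auto
    moreover have "(\<integral>t. ?h t * cnj (circle_pt 1 t) ^ n \<partial>\<mu>) * circle_pt r x ^ n = c n * circle_pt 1 x ^ n" for n
      unfolding c_def by (subst circle_pt_eq) (simp add: power_mult_distrib)
    ultimately show ?thesis
      using poisson_eq[OF h z] by (simp add: sums_iff)
  qed
  note ps = integral_arc_power_series[OF c]
  show "integrable arc_measure (\<lambda>x. poisson \<mu> h (circle_pt r x))"
    unfolding eq using ps(2)
    by (intro Bochner_Integration.integrable_diff integrable_mult_right integrable_Re) auto
  have "c 0 = complex_of_real (\<integral>t. h t \<partial>\<mu>)"
    by (simp add: c_def)
  then show "(\<integral>x. poisson \<mu> h (circle_pt r x) \<partial>arc_measure) = (\<integral>t. h t \<partial>\<mu>)"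
    unfolding eq using ps
    by (subst Bochner_Integration.integral_diff)
      (auto simp: integral_Re arc.prob_space)
qed

text \<open>Away from K the denominator of the kernel stays bounded below while the numerator
  \<open>1 - r\<^sup>2\<close> tends to 0.\<close>

lemma poisson_compact_tendsto_0:
  assumes K: "compact K" "K \<subseteq> {0..<1}" and x: "x \<in> {0..<1} - K"
  shows "((\<lambda>r. poisson \<mu> (indicator K) (circle_pt r x)) \<longlongrightarrow> 0) (at_left 1)"
proof -
  \<comment> \<open>Distances must be measured on the circle, where parameters near 0 and near 1 are
    close. Injectivity of the parametrisation on the half-open interval keeps the point of x off the
    compact image.\<close>
  have "compact (circle_pt 1 ` K)"
    unfolding circle_pt_def by (intro compact_continuous_image continuous_intros K)
  moreover have "circle_pt 1 x \<notin> circle_pt 1 ` K"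
    using circle_pt_inj[of x] x K(2) by blast
  ultimately obtain d where d: "d > 0" "\<And>y. y \<in> circle_pt 1 ` K \<Longrightarrow> d \<le> dist (circle_pt 1 x) y"
    using separate_point_closed compact_imp_closed by metis
  \<comment> \<open>Moving the point from radius 1 to r shifts it by \<open>1 - r < d / 2\<close>,
    which leaves at least half of the distance d.\<close>
  have bound: "\<bar>poisson \<mu> (indicator K) (circle_pt r x)\<bar> \<le> (1 - r\<^sup>2) / (d / 2)\<^sup>2"
    if r: "r \<in> {0<..<1}" "r > 1 - d / 2" for r
  proof -
    have z: "norm (circle_pt r x) < 1" using r by simp
    have Km: "K \<in> sets \<mu>"
      using K borel_compact[OF K(1)] by (auto simp: sets_eq sets_restrict_space)
    have "poisson \<mu> (indicator K) (circle_pt r x) \<le> (\<integral>t. (1 - r\<^sup>2) / (d / 2)\<^sup>2 \<partial>\<mu>)"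
      unfolding poisson_def
    proof (intro integral_mono integrable_poisson z)
      show "integrable \<mu> (indicat_real K)" using Km by (simp add: integrable_indicator_iff emeasure_eq_measure)
      fix t assume "t \<in> space \<mu>"
      have r1: "1 - r\<^sup>2 \<ge> 0" using r by (simp add: power_le_one)
      show "indicat_real K t * ((1 - (norm (circle_pt r x))\<^sup>2) / (norm (1 - circle_pt r x * cnj (circle_pt 1 t)))\<^sup>2)
          \<le> (1 - r\<^sup>2) / (d / 2)\<^sup>2"
      proof (cases "t \<in> K")
        case True
        \<comment> \<open>For w on the unit circle, multiplying by its conjugate turns
          \<open>norm (1 - z * cnj w)\<close> into the distance from w to z.\<close>
        have w: "circle_pt 1 t * cnj (circle_pt 1 t) = 1"
          by (simp add: complex_norm_square[symmetric])
        have "norm (1 - circle_pt r x * cnj (circle_pt 1 t))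
            = norm ((circle_pt 1 t - circle_pt r x) * cnj (circle_pt 1 t))"
          by (simp only: left_diff_distrib w)
        also have "\<dots> = norm ((circle_pt 1 t - circle_pt 1 x) + of_real (1 - r) * circle_pt 1 x)"
          by (subst circle_pt_eq[of r]) (simp add: norm_mult, simp add: algebra_simps)
        also have "\<dots> \<ge> norm (circle_pt 1 t - circle_pt 1 x) - norm (of_real (1 - r) * circle_pt 1 x)"
          by (rule norm_diff_ineq)
        finally have "norm (1 - circle_pt r x * cnj (circle_pt 1 t))
            \<ge> norm (circle_pt 1 t - circle_pt 1 x) - norm (of_real (1 - r) * circle_pt 1 x)" .
        moreover have "norm (of_real (1 - r) * circle_pt 1 x) = 1 - r"
          using r by (simp add: norm_mult del: of_real_diff)
        moreover have "norm (circle_pt 1 t - circle_pt 1 x) \<ge> d"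
          using d(2)[of "circle_pt 1 t"] True by (simp add: dist_norm norm_minus_commute)
        ultimately have "d / 2 \<le> norm (1 - circle_pt r x * cnj (circle_pt 1 t))"
          using r by linarith
        then have "(d / 2)\<^sup>2 \<le> (norm (1 - circle_pt r x * cnj (circle_pt 1 t)))\<^sup>2"
          using d(1) by (intro power_mono) auto
        then have "(1 - r\<^sup>2) / (norm (1 - circle_pt r x * cnj (circle_pt 1 t)))\<^sup>2 \<le> (1 - r\<^sup>2) / (d / 2)\<^sup>2"
          using d(1) r1 by (intro divide_left_mono) (auto intro!: mult_pos_pos intro: less_le_trans)
        then show ?thesis using True by simp
      qed (use r1 in auto)
    qed auto
    then show ?thesis
      using poisson_nonneg[OF z, of "indicator K"] by (simp add: prob_space)
  qed
  show ?thesis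
  proof (rule Lim_null_comparison)
    have "\<forall>\<^sub>F r in at_left (1::real). r \<in> {max 0 (1 - d / 2)<..<1}"
      by (rule eventually_at_leftI[of "max 0 (1 - d / 2)"]) (use d in auto)
    then show "\<forall>\<^sub>F r in at_left 1. norm (poisson \<mu> (indicator K) (circle_pt r x)) \<le> (1 - r\<^sup>2) / (d / 2)\<^sup>2"
      by eventually_elim (use bound in auto)
    have "((\<lambda>r. (1 - r\<^sup>2) / (d / 2)\<^sup>2) \<longlongrightarrow> (1 - 1\<^sup>2) / (d / 2)\<^sup>2) (at_left (1::real))"
      using d by (intro tendsto_intros) auto
    then show "((\<lambda>r. (1 - r\<^sup>2) / (d / 2)\<^sup>2) \<longlongrightarrow> 0) (at_left (1::real))" by simp
  qed
qed

section \<open>The Cauchy transform of the measure and the modulus of b\<close>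

lemma mu_plus_eq: "mu_plus \<mu> z = (\<integral>t. 1 / (1 - z * cnj (circle_pt 1 t)) \<partial>\<mu>)"
proof -
  have "exp (- (2 * of_real pi * \<i> * of_real x)) = cnj (circle_pt 1 x)" for x
    by (simp add: circle_pt_def exp_cnj)
  then show ?thesis by (simp add: mu_plus_def)
qed

text \<open>Positivity of the Poisson integral thus puts the values of \<open>mu_plus\<close> in the
  half plane of real part at least 1/2. Hence it has no zeros in the disc, and its reciprocal
  \<open>1 - b\<close> is bounded by 2.\<close>

lemma Re_mu_plus: "norm z < 1 \<Longrightarrow> 2 * Re (mu_plus \<mu> z) - 1 = poisson \<mu> (\<lambda>_. 1) z"
  by (subst poisson_eq) (auto simp: mu_plus_eq prob_space)

lemma norm_mu_plus_ge: "norm z < 1 \<Longrightarrow> norm (mu_plus \<mu> z) \<ge> 1 / 2"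
  using Re_mu_plus[of z] poisson_nonneg[of z "\<lambda>_. 1"] abs_Re_le_cmod[of "mu_plus \<mu> z"] by auto

lemma norm_inverse_mu_plus_le: "norm z < 1 \<Longrightarrow> norm (1 / mu_plus \<mu> z) \<le> 2"
  using divide_left_mono[OF norm_mu_plus_ge[of z], of 1] by (force simp: norm_divide)

text \<open>With \<open>b = (u - 1) / u\<close> the defect of \<open>\<bar>b\<bar>\<^sup>2\<close>
  from 1 is \<open>(2 * Re u - 1) / \<bar>u\<bar>\<^sup>2\<close>. The second factor is at most 4,
  so the defect is small wherever the Poisson integral of \<mu> is small.\<close>

lemma one_minus_norm_inner_b:
  assumes "norm z < 1"
  shows "1 - (norm (inner_b \<mu> z))\<^sup>2 = poisson \<mu> (\<lambda>_. 1) z * (norm (1 / mu_plus \<mu> z))\<^sup>2"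
proof -
  define u where "u = mu_plus \<mu> z"
  have u: "u \<noteq> 0" using norm_mu_plus_ge[OF assms] by (auto simp: u_def)
  have "inner_b \<mu> z = (u - 1) / u" using u by (simp add: inner_b_def u_def diff_divide_distrib)
  then have "norm (inner_b \<mu> z) = norm (u - 1) / norm u" by (simp only: norm_divide)
  then have "1 - (norm (inner_b \<mu> z))\<^sup>2 = ((norm u)\<^sup>2 - (norm (u - 1))\<^sup>2) / (norm u)\<^sup>2"
    using u by (simp add: power_divide diff_divide_distrib)
  also have "(norm u)\<^sup>2 - (norm (u - 1))\<^sup>2 = 2 * Re u - 1"
    unfolding cmod_power2 by (simp add: power2_eq_square algebra_simps)
  finally show ?thesis
    using Re_mu_plus[OF assms] by (simp add: u_def norm_divide power_divide)
qed

section \<open>Boundary behaviour for singular measures\<close>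

lemma mu_plus_sums:
  assumes "norm z < 1"
  shows "(\<lambda>n. (\<integral>t. cnj (circle_pt 1 t) ^ n \<partial>\<mu>) * z ^ n) sums mu_plus \<mu> z"
  using cauchy_transform_sums[OF circle_pt_measurable_\<mu>[of 1] _ _ assms, of "\<lambda>_. 1"]
  by (simp add: mu_plus_eq)

lemma mu_plus_measurable:
  assumes [measurable]: "circle_pt r \<in> borel_measurable M" and "0 \<le> r" "r < 1"
  shows "(\<lambda>x. mu_plus \<mu> (circle_pt r x)) \<in> borel_measurable M"
proof -
  have "(\<lambda>x. mu_plus \<mu> (circle_pt r x))
      = (\<lambda>x. \<Sum>n. (\<integral>t. cnj (circle_pt 1 t) ^ n \<partial>\<mu>) * circle_pt r x ^ n)"
    using mu_plus_sums assms by (intro ext sums_unique) simp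
  then show ?thesis by simp
qed

lemma sets_imp_borel: "A \<in> sets \<mu> \<Longrightarrow> A \<in> sets borel"
  unfolding sets_eq by (auto simp: sets_restrict_space)

text \<open>Singularity provides a Lebesgue null carrier, but points outside it may lie arbitrarily
  close to it. Inner regularity replaces it by a compact subset at the cost of mass less than
  \<delta>.\<close>

lemma compact_approximation_of_null_carrier:
  assumes "singular_wrt_lebesgue \<mu>" "\<delta> > 0"
  obtains K where "compact K" "K \<subseteq> {0..<1}" "K \<in> sets \<mu>" "emeasure lborel K = 0"
    "measure \<mu> (space \<mu> - K) < \<delta>"
proof -
  obtain N where N: "N \<in> sets \<mu>" "emeasure lborel N = 0" "emeasure \<mu> (space \<mu> - N) = 0"
    using assms(1) by (auto simp: singular_wrt_lebesgue_def)
  have Nb: "N \<in> sets borel" using N(1) by (rule sets_imp_borel)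
  have id: "(\<lambda>x. x) \<in> borel_measurable \<mu>" by (rule measurable_circle) simp
  \<comment> \<open>Inner regularity is applied to a Borel measure on the whole line, so \<mu> is
    pushed forward along the inclusion of the unit interval.\<close>
  define \<nu> where "\<nu> = distr \<mu> borel (\<lambda>x. x)"
  interpret \<nu>: finite_measure \<nu> unfolding \<nu>_def by (rule finite_measure_distr[OF id])
  have \<nu>_eq: "emeasure \<nu> A = emeasure \<mu> (A \<inter> {0..<1})" if "A \<in> sets borel" for A
    using that by (simp add: \<nu>_def emeasure_distr[OF id] space_eq)
  have "N \<inter> {0..<1} = N" using sets.sets_into_space[OF N(1)] by (auto simp: space_eq)
  then have "emeasure \<nu> N = emeasure \<mu> N" using \<nu>_eq[OF Nb] by simp
  also have "\<dots> = 1"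
    using N(1,3) prob_compl[OF N(1)] by (simp add: emeasure_eq_measure)
  finally have one: "emeasure \<nu> N = 1" .
  have "emeasure \<nu> N = (SUP K\<in>{K. K \<subseteq> N \<and> compact K}. emeasure \<nu> K)"
    by (rule inner_regular) (use Nb \<nu>.emeasure_finite in \<open>auto simp: \<nu>_def\<close>)
  moreover have "ennreal (1 - \<delta>) < 1" using assms(2) by (simp add: ennreal_less_one_iff)
  ultimately have "ennreal (1 - \<delta>) < (SUP K\<in>{K. K \<subseteq> N \<and> compact K}. emeasure \<nu> K)"
    using one by simp
  then obtain K where K: "K \<subseteq> N" "compact K" "ennreal (1 - \<delta>) < emeasure \<nu> K"
    by (auto simp: less_SUP_iff)
  have Kb: "K \<in> sets borel" using K(2) by (rule borel_compact)
  have K01: "K \<subseteq> {0..<1}" using K(1) sets.sets_into_space[OF N(1)] by (auto simp: space_eq)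
  have Km: "K \<in> sets \<mu>" using Kb K01 by (auto simp: sets_eq sets_restrict_space)
  have "emeasure lborel K \<le> emeasure lborel N" by (rule emeasure_mono) (use K Nb in auto)
  then have K0: "emeasure lborel K = 0" using N(2) by simp
  have "K \<inter> {0..<1} = K" using K01 by auto
  then have "ennreal (1 - \<delta>) < ennreal (measure \<mu> K)"
    using K(3) \<nu>_eq[OF Kb] by (simp add: emeasure_eq_measure)
  then have "1 - \<delta> < measure \<mu> K" by (simp add: ennreal_less_iff not_le[symmetric] ennreal_leI)
      (metis ennreal_leI not_le)
  then have "measure \<mu> (space \<mu> - K) < \<delta>" using prob_compl[OF Km] by simp
  then show thesis using that K(2) K01 Km K0 by blast
qed

text \<open>Convergence in Lebesgue measure suffices here, so that no maximal function is needed: the part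
  of the measure off \<open>K\<close> contributes at most \<open>4\<close> times its mass.\<close>

lemma inner_defect_tendsto_0:
  assumes "singular_wrt_lebesgue \<mu>"
  shows "((\<lambda>r. \<integral>x. 1 - (norm (inner_b \<mu> (circle_pt r x)))\<^sup>2 \<partial>arc_measure) \<longlongrightarrow> 0) (at_left 1)"
    (is "(?D \<longlongrightarrow> 0) _")
proof (rule tendstoI)
  interpret arc: prob_space arc_measure by (rule prob_space_arc_measure)
  fix e :: real assume e: "e > 0"
  \<comment> \<open>The part off K has mass below \<open>e / 8\<close> and is weighted by the factor
    4, so it contributes less than \<open>e / 2\<close>.\<close>
  obtain K where K: "compact K" "K \<subseteq> {0..<1}" "K \<in> sets \<mu>" "emeasure lborel K = 0"
    "measure \<mu> (space \<mu> - K) < e / 8"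
    using compact_approximation_of_null_carrier[OF assms, of "e / 8"] e by auto
  define h where "h = indicat_real K"
  define g where "g = indicat_real (space \<mu> - K)"
  have h: "integrable \<mu> h" and g: "integrable \<mu> g"
    using K(3) by (auto simp: h_def g_def integrable_indicator_iff emeasure_eq_measure)
  have hg: "poisson \<mu> (\<lambda>_. 1) z = poisson \<mu> h z + poisson \<mu> g z" if "norm z < 1" for z
  proof -
    have "poisson \<mu> (\<lambda>_. 1) z = poisson \<mu> (\<lambda>t. h t + g t) z"
      unfolding poisson_def by (rule Bochner_Integration.integral_cong)
        (auto simp: h_def g_def indicator_def)
    then show ?thesis using poisson_add[OF h g that] by simp
  qed
  define d where "d r x = 1 - (norm (inner_b \<mu> (circle_pt r x)))\<^sup>2" for r x
  \<comment> \<open>The Poisson integral of h can be large near K. Capping it at 1 is harmless,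
    since the defect never exceeds 1, and it yields a constant majorant for dominated
    convergence.\<close>
  define q where "q r x = min 1 (4 * poisson \<mu> h (circle_pt r x))" for r x
  have hint: "integrable arc_measure (\<lambda>x. poisson \<mu> h (circle_pt r x))"
    and gint: "integrable arc_measure (\<lambda>x. poisson \<mu> g (circle_pt r x))" if "r \<in> {0<..<1}" for r
    using that integrable_poisson_arc h g by auto
  have q_meas: "q r \<in> borel_measurable arc_measure" if "r \<in> {0<..<1}" for r
    unfolding q_def using hint[OF that] by measurable
  have q_bd: "0 \<le> q r x" "q r x \<le> 1" if "r \<in> {0<..<1}" for r x
    using that poisson_nonneg[of "circle_pt r x" h] by (auto simp: q_def h_def)
  have d_bd: "0 \<le> d r x" "d r x \<le> 1" "d r x \<le> q r x + 4 * poisson \<mu> g (circle_pt r x)"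
    if r: "r \<in> {0<..<1}" for r x
  proof -
    have z: "norm (circle_pt r x) < 1" using r by simp
    have P: "poisson \<mu> h (circle_pt r x) \<ge> 0" "poisson \<mu> g (circle_pt r x) \<ge> 0"
      using poisson_nonneg[OF z] by (auto simp: h_def g_def)
    have u: "(norm (1 / mu_plus \<mu> (circle_pt r x)))\<^sup>2 \<le> 2\<^sup>2"
      by (intro power_mono norm_inverse_mu_plus_le z) auto
    have d: "d r x = (poisson \<mu> h (circle_pt r x) + poisson \<mu> g (circle_pt r x))
        * (norm (1 / mu_plus \<mu> (circle_pt r x)))\<^sup>2"
      unfolding d_def one_minus_norm_inner_b[OF z] hg[OF z] ..
    show "0 \<le> d r x" unfolding d using P by (intro mult_nonneg_nonneg) auto
    show d1: "d r x \<le> 1" by (simp add: d_def)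
    have "d r x \<le> (poisson \<mu> h (circle_pt r x) + poisson \<mu> g (circle_pt r x)) * 2\<^sup>2"
      unfolding d using P u by (intro mult_left_mono) auto
    then show "d r x \<le> q r x + 4 * poisson \<mu> g (circle_pt r x)"
      using d1 P by (auto simp: q_def min_def)
  qed
  have d_int: "integrable arc_measure (d r)" if "r \<in> {0<..<1}" for r
  proof (rule arc.integrable_const_bound[where B = 1])
    have [measurable]: "(\<lambda>x. mu_plus \<mu> (circle_pt r x)) \<in> borel_measurable arc_measure"
      using that by (intro mu_plus_measurable) auto
    show "d r \<in> borel_measurable arc_measure"
      unfolding d_def inner_b_def by measurable
  qed (use d_bd(1,2)[OF that] in auto)
  have q_int: "integrable arc_measure (q r)" if "r \<in> {0<..<1}" for r
    by (rule arc.integrable_const_bound[where B = 1]) (use q_bd[OF that] q_meas[OF that] in auto)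
  have D_le: "?D r \<le> (\<integral>x. q r x \<partial>arc_measure) + e / 2" if r: "r \<in> {0<..<1}" for r
  proof -
    have "?D r \<le> (\<integral>x. q r x + 4 * poisson \<mu> g (circle_pt r x) \<partial>arc_measure)"
      using d_bd(3)[OF r] unfolding d_def[symmetric]
      by (intro integral_mono Bochner_Integration.integrable_add integrable_mult_right gint d_int q_int r)
    \<comment> \<open>Conservation of mass under Poisson integration makes this term independent of
      r.\<close>
    also have "\<dots> = (\<integral>x. q r x \<partial>arc_measure) + 4 * (\<integral>t. g t \<partial>\<mu>)"
      using r gint[OF r] q_int[OF r] integral_poisson_arc[OF g, of r] by simp
    also have "(\<integral>t. g t \<partial>\<mu>) = measure \<mu> (space \<mu> - K)"
      by (simp add: g_def Int_absorb2)
    finally show ?thesis using K(5) by simp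
  qed
  have "((\<lambda>r. \<integral>x. q r x \<partial>arc_measure) \<longlongrightarrow> 0) (at_left 1)"
  proof (rule tendsto_at_left_sequentially[of 0])
    fix S :: "nat \<Rightarrow> real"
    assume S: "\<And>n. S n < 1" "\<And>n. 0 < S n" "S \<longlonglongrightarrow> 1"
    have S': "filterlim S (at_left 1) sequentially"
      using S less_imp_neq[OF S(1)] by (auto simp: filterlim_at)
    have "K \<in> null_sets lborel"
      using K(4) borel_compact[OF K(1)] by (auto simp: null_sets_def)
    \<comment> \<open>The endpoint 1 belongs to the interval of \<open>arc_measure\<close> but not
      to the space of \<mu>, so it is discarded together with K.\<close>
    then have "AE x in lborel. x \<notin> K \<union> {1}"
      by (intro AE_not_in null_sets.Un finite_imp_null_set_lborel[of "{1}"]) auto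
    then have AE: "AE x in arc_measure. x \<in> {0..<1} - K"
      unfolding arc_measure_def
      by (subst AE_restrict_space_iff, simp) (rule eventually_mono, auto)
    have "(\<lambda>n. \<integral>x. q (S n) x \<partial>arc_measure) \<longlonglongrightarrow> (\<integral>x. 0 \<partial>arc_measure)"
    proof (rule integral_dominated_convergence[where w = "\<lambda>_. 1"])
      show "AE x in arc_measure. (\<lambda>n. q (S n) x) \<longlonglongrightarrow> 0"
        using AE
      proof eventually_elim
        case (elim x)
        have "(\<lambda>n. poisson \<mu> h (circle_pt (S n) x)) \<longlonglongrightarrow> 0"
          unfolding h_def by (rule filterlim_compose[OF poisson_compact_tendsto_0[OF K(1,2) elim] S'])
        then have "(\<lambda>n. q (S n) x) \<longlonglongrightarrow> min 1 (4 * 0)"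
          unfolding q_def by (intro tendsto_intros)
        then show ?case by simp
      qed
      show "AE x in arc_measure. norm (q (S n) x) \<le> 1" for n
        using q_bd[of "S n"] S by auto
    qed (use q_meas S in auto)
    then show "(\<lambda>n. \<integral>x. q (S n) x \<partial>arc_measure) \<longlonglongrightarrow> 0" by simp
  qed simp
  then have "\<forall>\<^sub>F r in at_left 1. dist (\<integral>x. q r x \<partial>arc_measure) 0 < e / 2"
    using e by (intro tendstoD) auto
  moreover have "\<forall>\<^sub>F r in at_left (1::real). r \<in> {0<..<1}"
    by (rule eventually_at_leftI[of 0]) auto
  ultimately show "\<forall>\<^sub>F r in at_left 1. dist (?D r) 0 < e"
  proof eventually_elim
    case (elim r)
    have "?D r \<ge> 0"
      using d_bd(1)[OF elim(2)] unfolding d_def by (intro integral_nonneg_AE AE_I2)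
    then show ?case using D_le[OF elim(2)] elim(1) by (simp add: dist_real_def)
  qed
qed

end

section \<open>The coefficients of the inner function\<close>

lemma conv_radius_ge_1I:
  fixes c :: "nat \<Rightarrow> complex"
  assumes "\<And>z. norm z < 1 \<Longrightarrow> summable (\<lambda>n. c n * z ^ n)"
  shows "conv_radius c \<ge> 1"
  by (rule conv_radius_geI_ex') (auto intro!: assms)

lemma less_conv_radius: "norm z < 1 \<Longrightarrow> R \<ge> 1 \<Longrightarrow> ereal (norm z) < R"
  by (rule less_le_trans[of _ 1]) auto

text \<open>Here \<alpha> is given as the coefficient sequence of \<open>1 / mu_plus\<close>, which
  equals \<open>1 - b\<close>. The spectral identity is written with powers of a boundary point and
  of its conjugate, the shape of the Gram entries in \<open>parseval_limit\<close>.\<close>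

locale singular_stationary = circle_measure +
  fixes \<phi> :: "nat \<Rightarrow> 'a::complex_hilbert" and \<alpha> :: "nat \<Rightarrow> complex"
  assumes norm_\<phi>: "norm (\<phi> n) = 1"
    and stationary: "cinner (\<phi> (n + k)) (\<phi> (m + k)) = cinner (\<phi> n) (\<phi> m)"
    and spectral: "cinner (\<phi> n) (\<phi> m) = (\<integral>t. circle_pt 1 t ^ n * cnj (circle_pt 1 t) ^ m \<partial>\<mu>)"
    and singular: "singular_wrt_lebesgue \<mu>"
    and coeff: "norm z < 1 \<Longrightarrow> (\<lambda>n. \<alpha> n * z ^ n) sums (1 / mu_plus \<mu> z)"
begin

text \<open>The Taylor series of \<open>mu_plus\<close> at 0. By stationarity its coefficients are
  also the entries of the Gram matrix on and above the diagonal.\<close>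

definition gram_fps :: "complex fps" where
  "gram_fps = Abs_fps (\<lambda>n. cinner (\<phi> 0) (\<phi> n))"

definition coeff_fps :: "complex fps" where
  "coeff_fps = Abs_fps \<alpha>"

lemma conv_radius_gram: "fps_conv_radius gram_fps \<ge> 1"
  and eval_gram: "norm z < 1 \<Longrightarrow> eval_fps gram_fps z = mu_plus \<mu> z"
proof -
  have "(\<lambda>n. cinner (\<phi> 0) (\<phi> n) * z ^ n) sums mu_plus \<mu> z" if "norm z < 1" for z
    using mu_plus_sums[OF that] by (simp add: spectral)
  note * = this
  show "fps_conv_radius gram_fps \<ge> 1"
    unfolding fps_conv_radius_def using * by (intro conv_radius_ge_1I) (auto simp: gram_fps_def sums_iff)
  show "norm z < 1 \<Longrightarrow> eval_fps gram_fps z = mu_plus \<mu> z"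
    unfolding eval_fps_def using * by (simp add: gram_fps_def sums_iff)
qed

lemma conv_radius_coeff: "fps_conv_radius coeff_fps \<ge> 1"
  and eval_coeff: "norm z < 1 \<Longrightarrow> eval_fps coeff_fps z = 1 / mu_plus \<mu> z"
proof -
  show "fps_conv_radius coeff_fps \<ge> 1"
    unfolding fps_conv_radius_def using coeff by (intro conv_radius_ge_1I) (auto simp: coeff_fps_def sums_iff)
  show "norm z < 1 \<Longrightarrow> eval_fps coeff_fps z = 1 / mu_plus \<mu> z"
    unfolding eval_fps_def using coeff by (simp add: coeff_fps_def sums_iff)
qed

text \<open>The two analytic functions are reciprocal on the disc, and a germ at 0 determines its
  formal power series. Working formally, convolution with \<alpha> inverts convolution with the Gram
  coefficients.\<close>

lemma coeff_times_gram: "coeff_fps * gram_fps = 1"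
proof (rule eval_fps_eqD)
  have "fps_conv_radius (coeff_fps * gram_fps) \<ge> 1"
    using fps_conv_radius_mult[of coeff_fps gram_fps] conv_radius_coeff conv_radius_gram by (meson min.boundedI order_trans)
  then show "fps_conv_radius (coeff_fps * gram_fps) > 0"
    by (rule less_le_trans[rotated]) simp
  have "eval_fps (coeff_fps * gram_fps) z = 1" if "z \<in> ball 0 1" for z
    using that norm_mu_plus_ge[of z] eval_coeff[of z] eval_gram[of z]
    by (subst eval_fps_mult) (auto intro!: less_conv_radius conv_radius_coeff conv_radius_gram)
  then show "\<forall>\<^sub>F z in nhds 0. eval_fps (coeff_fps * gram_fps) z = eval_fps 1 z"
    by (intro eventually_nhds_in_open[of "ball 0 1", THEN eventually_mono]) auto
qed simp

section \<open>Coefficients of \<open>(1 - b)\<close> times a power series, and norms of Abel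
  sums\<close>

definition coeff_conv :: "(nat \<Rightarrow> complex) \<Rightarrow> nat \<Rightarrow> complex" where
  "coeff_conv c n = (\<Sum>j\<le>n. \<alpha> (n - j) * c j)"

lemma coeff_conv_eq_fps: "coeff_conv c n = fps_nth (Abs_fps c * coeff_fps) n"
  by (simp add: coeff_conv_def coeff_fps_def fps_mult_nth atLeast0AtMost mult.commute[of "\<alpha> _"])

lemma abel_term_eq: "abel_term \<alpha> \<phi> c r n = (of_real r ^ n * coeff_conv c n) *\<^sub>C \<phi> n"
  by (simp add: abel_term_def coeff_conv_def)

lemma abel_term_eq_scaleR: "abel_term \<alpha> \<phi> c r n = r ^ n *\<^sub>R (coeff_conv c n *\<^sub>C \<phi> n)"
  by (simp add: abel_term_eq scaleR_scaleC scaleC_scaleC)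

lemma abel_term_add: "abel_term \<alpha> \<phi> (\<lambda>j. c j + d j) r n = abel_term \<alpha> \<phi> c r n + abel_term \<alpha> \<phi> d r n"
  by (simp add: abel_term_def ring_distribs sum.distrib scaleC_add_left)

lemma abel_term_scale: "abel_term \<alpha> \<phi> (\<lambda>j. a * c j) r n = a *\<^sub>C abel_term \<alpha> \<phi> c r n"
  by (simp add: abel_term_def sum_distrib_left scaleC_scaleC mult_ac)

lemma cinner_eq_gram: "k \<le> n \<Longrightarrow> cinner (\<phi> k) (\<phi> n) = fps_nth gram_fps (n - k)"
  using stationary[of 0 k "n - k"] by (simp add: gram_fps_def)

text \<open>The sum is a coefficient of the product of c, \<open>coeff_fps\<close> and
  \<open>gram_fps\<close>, of which the last two cancel. This is the Kaczmarz recursion: splitting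
  off the term \<open>k = n\<close> shows that \<open>coeff_conv c n\<close> is what the earlier
  terms miss of \<open>c n\<close>.\<close>

lemma sum_coeff_conv_gram: "(\<Sum>k\<le>n. coeff_conv c k * cinner (\<phi> k) (\<phi> n)) = c n"
proof -
  have "(\<Sum>k\<le>n. coeff_conv c k * cinner (\<phi> k) (\<phi> n)) = fps_nth (Abs_fps c * coeff_fps * gram_fps) n"
    by (simp add: fps_mult_nth[of "Abs_fps c * coeff_fps"] atLeast0AtMost coeff_conv_eq_fps cinner_eq_gram)
  then show ?thesis by (simp add: mult.assoc coeff_times_gram)
qed

lemma
  assumes c: "conv_radius c \<ge> 1" and r: "0 \<le> r" "r < 1"
  shows summable_norm_coeff_conv: "summable (\<lambda>n. norm (of_real r ^ n * coeff_conv c n))"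
    and suminf_coeff_conv: "(\<Sum>n. of_real r ^ n * coeff_conv c n * circle_pt 1 t ^ n)
      = power_series c (circle_pt r t) * (1 / mu_plus \<mu> (circle_pt r t))"
proof -
  have c': "fps_conv_radius (Abs_fps c) \<ge> 1" using c by (simp add: fps_conv_radius_def)
  have "fps_conv_radius (Abs_fps c * coeff_fps) \<ge> 1"
    using fps_conv_radius_mult[of "Abs_fps c" coeff_fps] conv_radius_coeff c' by (meson min.boundedI order_trans)
  then have "summable (\<lambda>n. norm (coeff_conv c n * of_real r ^ n))"
    unfolding coeff_conv_eq_fps fps_conv_radius_def using r
    by (intro abs_summable_in_conv_radius less_conv_radius) auto
  then show "summable (\<lambda>n. norm (of_real r ^ n * coeff_conv c n))"
    by (simp add: mult.commute)
  have z: "norm (circle_pt r t) < 1" using r by simp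
  have "(\<Sum>n. of_real r ^ n * coeff_conv c n * circle_pt 1 t ^ n) = eval_fps (Abs_fps c * coeff_fps) (circle_pt r t)"
    unfolding eval_fps_def coeff_conv_eq_fps by (subst (2) circle_pt_eq) (simp add: power_mult_distrib mult_ac)
  also have "\<dots> = eval_fps (Abs_fps c) (circle_pt r t) * eval_fps coeff_fps (circle_pt r t)"
    by (intro eval_fps_mult less_conv_radius z c' conv_radius_coeff)
  finally show "(\<Sum>n. of_real r ^ n * coeff_conv c n * circle_pt 1 t ^ n)
      = power_series c (circle_pt r t) * (1 / mu_plus \<mu> (circle_pt r t))"
    unfolding eval_coeff[OF z] by (simp add: eval_fps_def power_series_def)
qed

lemma summable_abel_term:
  assumes "conv_radius c \<ge> 1" "0 \<le> r" "r < 1"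
  shows "summable (abel_term \<alpha> \<phi> c r)"
  using summable_scaleC[OF summable_norm_coeff_conv[OF assms], of \<phi>] norm_\<phi>
  by (simp add: abel_term_eq[abs_def])

text \<open>The isometry into \<open>L\<^sup>2(\<mu>)\<close> at the level of norms: finite sums in
  H and trigonometric polynomials have the same Gram sums, and both sides are their limits.\<close>

lemma norm_abel_sum:
  assumes "conv_radius c \<ge> 1" "0 \<le> r" "r < 1"
  shows "(norm (\<Sum>n. abel_term \<alpha> \<phi> c r n))\<^sup>2 = (\<integral>t. (norm (1 / mu_plus \<mu> (circle_pt r t)))\<^sup>2
      * (norm (power_series c (circle_pt r t)))\<^sup>2 \<partial>\<mu>)"
proof -
  have "(\<lambda>N. \<Sum>n<N. abel_term \<alpha> \<phi> c r n) \<longlonglongrightarrow> (\<Sum>n. abel_term \<alpha> \<phi> c r n)"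
    by (intro summable_LIMSEQ summable_abel_term assms)
  then have 1: "(\<lambda>N. complex_of_real ((norm (\<Sum>n<N. abel_term \<alpha> \<phi> c r n))\<^sup>2))
      \<longlonglongrightarrow> complex_of_real ((norm (\<Sum>n. abel_term \<alpha> \<phi> c r n))\<^sup>2)"
    by (intro tendsto_intros)
  have "(\<lambda>N. complex_of_real ((norm (\<Sum>n<N. abel_term \<alpha> \<phi> c r n))\<^sup>2))
      \<longlonglongrightarrow> complex_of_real (\<integral>t. (norm (\<Sum>n. of_real r ^ n * coeff_conv c n * circle_pt 1 t ^ n))\<^sup>2 \<partial>\<mu>)"
    unfolding abel_term_eq norm_sum_scaleC_sq spectral
    by (rule parseval_limit[OF finite_measure_axioms circle_pt_measurable_\<mu>])
      (use summable_norm_coeff_conv[OF assms] in auto)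
  from LIMSEQ_unique[OF 1 this]
  have "(norm (\<Sum>n. abel_term \<alpha> \<phi> c r n))\<^sup>2
      = (\<integral>t. (norm (\<Sum>n. of_real r ^ n * coeff_conv c n * circle_pt 1 t ^ n))\<^sup>2 \<partial>\<mu>)"
    by (simp only: of_real_eq_iff)
  then show ?thesis
    unfolding suminf_coeff_conv[OF assms] by (simp add: norm_mult norm_divide power_divide mult.commute)
qed

section \<open>Square summability of \<alpha> and the decay of 1 - b in the mean\<close>

lemma coeff_conv_delta: "coeff_conv (\<lambda>n. if n = 0 then 1 else 0) = \<alpha>"
proof
  fix n
  have "Abs_fps (\<lambda>n. if n = 0 then 1 else 0 :: complex) = 1" by (rule fps_ext) simp
  then show "coeff_conv (\<lambda>n. if n = 0 then 1 else 0) n = \<alpha> n" by (simp add: coeff_conv_eq_fps coeff_fps_def)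
qed

lemma \<alpha>_0: "\<alpha> 0 = 1"
  using sum_coeff_conv_gram[of "\<lambda>n. if n = 0 then 1 else 0" 0] cinner_self[of "\<phi> 0"]
  by (simp add: coeff_conv_delta norm_\<phi>)

text \<open>The recursion for the unit sequence has right side 0 at every index
  \<open>Suc n\<close>, so the partial sum up to n has inner product
  \<open>- \<alpha> (Suc n)\<close> with \<open>\<phi> (Suc n)\<close>. Adding the next term is
  therefore a projection step.\<close>

lemma coeff_partial_sum_norm:
  "(norm (\<Sum>k\<le>n. \<alpha> k *\<^sub>C \<phi> k))\<^sup>2 + (\<Sum>k<n. (norm (\<alpha> (Suc k)))\<^sup>2) = 1"
proof -
  define Y where "Y n = (\<Sum>k\<le>n. \<alpha> k *\<^sub>C \<phi> k)" for n
  have ip: "cinner (Y n) (\<phi> (Suc n)) = - \<alpha> (Suc n)" for n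
    using sum_coeff_conv_gram[of "\<lambda>n. if n = 0 then 1 else 0" "Suc n"] cinner_self[of "\<phi> (Suc n)"]
    by (simp add: coeff_conv_delta Y_def cinner_sum_left cinner_scaleC_left norm_\<phi> eq_neg_iff_add_eq_0)
  have "(norm (Y n))\<^sup>2 + (\<Sum>k<n. (norm (cinner (Y k) (\<phi> (Suc k))))\<^sup>2) = (norm (Y 0))\<^sup>2"
  proof (rule residual_iteration_norm)
    show "Y (Suc n) = Y n - cinner (Y n) (\<phi> (Suc n)) *\<^sub>C \<phi> (Suc n)" for n
      unfolding ip by (simp add: Y_def complex_vector.scale_minus_left)
  qed (rule norm_\<phi>)
  then show ?thesis unfolding ip by (simp add: Y_def \<alpha>_0 norm_\<phi>)
qed

text \<open>At most 1 follows from the norm identity for the partial sums. For the converse,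
  Parseval on each circle of radius r bounds the mean of \<open>\<bar>b\<bar>\<^sup>2\<close> by the
  sum of the squares, while that mean tends to 1 for singular \<mu>.\<close>

lemma coeff_square_sums: "(\<lambda>k. (norm (\<alpha> (Suc k)))\<^sup>2) sums 1"
proof -
  \<comment> \<open>The Taylor coefficients of \<open>inner_b\<close>; the constant one is 0 because
    \<open>\<alpha> 0 = 1\<close>.\<close>
  define b where "b n = (if n = 0 then 0 else - \<alpha> n)" for n
  have partial: "(\<Sum>k<n. (norm (\<alpha> (Suc k)))\<^sup>2) \<le> 1" for n
    using coeff_partial_sum_norm[of n] zero_le_power2[of "norm (\<Sum>k\<le>n. \<alpha> k *\<^sub>C \<phi> k)"] by linarith
  then have sm: "summable (\<lambda>k. (norm (\<alpha> (Suc k)))\<^sup>2)"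
    by (intro summableI_nonneg_bounded[where x = 1]) auto
  have le1: "(\<Sum>k. (norm (\<alpha> (Suc k)))\<^sup>2) \<le> 1"
    by (rule suminf_le_const[OF sm partial])
  have "summable (\<lambda>k. (norm (b (Suc k)))\<^sup>2)" using sm by (simp add: b_def)
  then have smb: "summable (\<lambda>k. (norm (b k))\<^sup>2)"
    using summable_Suc_iff[of "\<lambda>k. (norm (b k))\<^sup>2"] by blast
  have b0: "(\<Sum>k. (norm (b k))\<^sup>2) = (\<Sum>k. (norm (\<alpha> (Suc k)))\<^sup>2)"
    using suminf_split_head[OF smb] by (simp add: b_def)
  have D: "(\<integral>x. 1 - (norm (inner_b \<mu> (circle_pt r x)))\<^sup>2 \<partial>arc_measure)
      \<ge> 1 - (\<Sum>k. (norm (\<alpha> (Suc k)))\<^sup>2)" if r: "r \<in> {0<..<1}" for r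
  proof -
    interpret arc: prob_space arc_measure by (rule prob_space_arc_measure)
    have "summable (\<lambda>n. norm (\<alpha> n * of_real r ^ n))"
      using conv_radius_coeff r unfolding coeff_fps_def fps_conv_radius_def
      by (intro abs_summable_in_conv_radius less_conv_radius) auto
    then have c: "summable (\<lambda>n. norm (b n * of_real r ^ n))"
      by (rule summable_comparison_test[rotated, OF _ exI[of _ 0]]) (auto simp: b_def)
    have bz: "inner_b \<mu> (circle_pt r x) = (\<Sum>n. b n * of_real r ^ n * circle_pt 1 x ^ n)" for x
    proof -
      have "norm (circle_pt r x) < 1" using r by simp
      from coeff[OF this] have "(\<lambda>n. (if n = 0 then 1 else 0) - \<alpha> n * circle_pt r x ^ n) sums
          (1 - 1 / mu_plus \<mu> (circle_pt r x))"
        by (intro sums_diff sums_single[of 0 "\<lambda>_. 1", simplified])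
      moreover have "(if n = 0 then 1 else 0) - \<alpha> n * circle_pt r x ^ n
          = b n * of_real r ^ n * circle_pt 1 x ^ n" for n
        by (subst circle_pt_eq) (simp add: b_def \<alpha>_0 power_mult_distrib)
      ultimately show ?thesis by (simp add: inner_b_def sums_iff)
    qed
    have p: "(\<lambda>n. (norm (b n * of_real r ^ n))\<^sup>2) sums
        (\<integral>x. (norm (inner_b \<mu> (circle_pt r x)))\<^sup>2 \<partial>arc_measure)"
      unfolding bz by (rule parseval_arc[OF c])
    have "(norm (b n * of_real r ^ n))\<^sup>2 \<le> (norm (b n))\<^sup>2" for n
      using r by (intro power_mono) (auto simp: norm_mult norm_power intro!: mult_left_le power_le_one)
    then have le: "(\<integral>x. (norm (inner_b \<mu> (circle_pt r x)))\<^sup>2 \<partial>arc_measure) \<le> (\<Sum>k. (norm (b k))\<^sup>2)"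
      unfolding sums_unique[OF p] by (intro suminf_le sums_summable[OF p] smb)
    have "integrable arc_measure (\<lambda>x. (norm (inner_b \<mu> (circle_pt r x)))\<^sup>2)"
    proof (rule arc.integrable_const_bound[where B = 1])
      have "norm (circle_pt r x) < 1" for x using r by simp
      from one_minus_norm_inner_b[OF this] have "(norm (inner_b \<mu> (circle_pt r x)))\<^sup>2 \<le> 1" for x
        using poisson_nonneg[of "circle_pt r x" "\<lambda>_. 1"] r
        by (smt (verit) \<open>\<And>x. norm (circle_pt r x) < 1\<close> mult_nonneg_nonneg zero_le_power2)
      then show "AE x in arc_measure. norm ((norm (inner_b \<mu> (circle_pt r x)))\<^sup>2) \<le> 1"
        by simp
    qed (unfold bz, measurable)
    then show ?thesis using le b0 by (simp add: arc.prob_space)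
  qed
  have "1 - (\<Sum>k. (norm (\<alpha> (Suc k)))\<^sup>2) \<le> 0"
  proof (rule tendsto_lowerbound[OF inner_defect_tendsto_0[OF singular]])
    have "\<forall>\<^sub>F r in at_left (1::real). r \<in> {0<..<1}"
      by (rule eventually_at_leftI[of 0]) auto
    then show "\<forall>\<^sub>F r in at_left 1. 1 - (\<Sum>k. (norm (\<alpha> (Suc k)))\<^sup>2)
        \<le> (\<integral>x. 1 - (norm (inner_b \<mu> (circle_pt r x)))\<^sup>2 \<partial>arc_measure)"
      by eventually_elim (rule D)
  qed simp
  then show ?thesis using le1 sm by (simp add: sums_iff)
qed

text \<open>This is \<open>norm_abel_sum\<close> for the constant power series 1: the Abel sums of
  the \<open>\<alpha> k *\<^sub>C \<phi> k\<close> are averages of partial sums whose squared norms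
  tend to \<open>1 - 1 = 0\<close>.\<close>

lemma integral_inverse_mu_plus_tendsto_0:
  "((\<lambda>r. \<integral>t. (norm (1 / mu_plus \<mu> (circle_pt r t)))\<^sup>2 \<partial>\<mu>) \<longlongrightarrow> 0) (at_left 1)"
proof -
  let ?X = "\<lambda>n. \<Sum>k\<le>n. \<alpha> k *\<^sub>C \<phi> k"
  let ?\<delta> = "\<lambda>n. if n = 0 then 1 else 0 :: complex"
  have "(\<lambda>n. 1 - (\<Sum>k<n. (norm (\<alpha> (Suc k)))\<^sup>2)) \<longlonglongrightarrow> 1 - 1"
    using coeff_square_sums unfolding sums_def by (intro tendsto_intros)
  moreover have "1 - (\<Sum>k<n. (norm (\<alpha> (Suc k)))\<^sup>2) = (norm (?X n))\<^sup>2" for n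
    using coeff_partial_sum_norm[of n] by simp
  ultimately have "(\<lambda>n. sqrt ((norm (?X n))\<^sup>2)) \<longlonglongrightarrow> sqrt 0"
    by (intro tendsto_real_sqrt) simp
  then have X0: "?X \<longlonglongrightarrow> 0" by (simp add: tendsto_norm_zero_iff)
  have Xb: "norm (?X n) \<le> 1" for n
  proof (rule power2_le_imp_le)
    show "(norm (?X n))\<^sup>2 \<le> 1\<^sup>2"
      using coeff_partial_sum_norm[of n] sum_nonneg[of "{..<n}" "\<lambda>k. (norm (\<alpha> (Suc k)))\<^sup>2"] by simp
  qed simp
  have \<delta>: "conv_radius ?\<delta> \<ge> 1"
    by (rule conv_radius_ge_1I) (rule summable_finite[of "{0}"], auto)
  have p: "power_series ?\<delta> z = 1" for z
    unfolding power_series_def by (subst suminf_finite[of "{0}"]) auto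
  have "((\<lambda>r. (norm ((1 - r) *\<^sub>R (\<Sum>n. r ^ n *\<^sub>R ?X n)))\<^sup>2) \<longlongrightarrow> (norm (0::'a))\<^sup>2) (at_left 1)"
    by (intro tendsto_intros abel_mean_tendsto_0[OF X0 Xb])
  moreover have "\<forall>\<^sub>F r in at_left (1::real). r \<in> {0<..<1}"
    by (rule eventually_at_leftI[of 0]) auto
  then have "\<forall>\<^sub>F r in at_left 1. (norm ((1 - r) *\<^sub>R (\<Sum>n. r ^ n *\<^sub>R ?X n)))\<^sup>2
      = (\<integral>t. (norm (1 / mu_plus \<mu> (circle_pt r t)))\<^sup>2 \<partial>\<mu>)"
  proof eventually_elim
    case (elim r)
    then have "(\<Sum>n. abel_term \<alpha> \<phi> ?\<delta> r n) = (1 - r) *\<^sub>R (\<Sum>n. r ^ n *\<^sub>R ?X n)"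
      using abel_sum_by_parts[OF Xb, of r] by (simp add: abel_term_eq_scaleR coeff_conv_delta sums_iff)
    then show ?case
      using norm_abel_sum[OF \<delta>, of r] elim by (simp add: p)
  qed
  ultimately have "((\<lambda>r. \<integral>t. (norm (1 / mu_plus \<mu> (circle_pt r t)))\<^sup>2 \<partial>\<mu>)
      \<longlongrightarrow> (norm (0::'a))\<^sup>2) (at_left 1)"
    by (rule Lim_transform_eventually)
  then show ?thesis by simp
qed

section \<open>Perturbed Abel sums\<close>

lemma power_series_measurable [measurable]:
  "(\<lambda>t. power_series c (circle_pt r t)) \<in> borel_measurable \<mu>"
  unfolding power_series_def by measurable

lemma power_series_circle_bounded:
  assumes "conv_radius c \<ge> 1" "0 \<le> r" "r < 1"
  obtains B where "B \<ge> 0" "\<And>t. norm (power_series c (circle_pt r t)) \<le> B"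
proof -
  have s: "summable (\<lambda>n. norm (c n * of_real r ^ n))"
    using assms by (intro abs_summable_in_conv_radius less_conv_radius) auto
  have "norm (power_series c (circle_pt r t)) \<le> (\<Sum>n. norm (c n * of_real r ^ n))" for t
    unfolding power_series_def by (rule norm_suminf_le[OF _ s]) (simp add: norm_mult norm_power)
  then show thesis
    using that suminf_nonneg[OF s] by auto
qed

lemma integrable_weighted:
  assumes "conv_radius c \<ge> 1" "0 \<le> r" "r < 1"
  shows "integrable \<mu> (\<lambda>t. (norm (1 / mu_plus \<mu> (circle_pt r t)))\<^sup>2
      * (norm (power_series c (circle_pt r t)))\<^sup>2)"
    and "integrable \<mu> (\<lambda>t. (norm (1 / mu_plus \<mu> (circle_pt r t)))\<^sup>2)"
    and "p \<ge> 0 \<Longrightarrow> integrable \<mu> (\<lambda>t. norm (power_series c (circle_pt r t)) powr p)"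
proof -
  note [measurable] = mu_plus_measurable[OF circle_pt_measurable_\<mu> assms(2,3)]
  obtain B where B: "B \<ge> 0" "\<And>t. norm (power_series c (circle_pt r t)) \<le> B"
    using power_series_circle_bounded[OF assms] by blast
  have u: "(norm (1 / mu_plus \<mu> (circle_pt r t)))\<^sup>2 \<le> 2\<^sup>2" for t
    using assms by (intro power_mono norm_inverse_mu_plus_le) auto
  have v: "(norm (power_series c (circle_pt r t)))\<^sup>2 \<le> B\<^sup>2" for t
    using B by (intro power_mono) auto
  show "integrable \<mu> (\<lambda>t. (norm (1 / mu_plus \<mu> (circle_pt r t)))\<^sup>2)"
    by (rule integrable_const_bound[where B = "2\<^sup>2"]) (use u in auto)
  show "integrable \<mu> (\<lambda>t. (norm (1 / mu_plus \<mu> (circle_pt r t)))\<^sup>2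
      * (norm (power_series c (circle_pt r t)))\<^sup>2)"
    by (rule integrable_const_bound[where B = "2\<^sup>2 * B\<^sup>2"])
      (use mult_mono[OF u v] in \<open>auto simp: norm_mult\<close>)
  show "integrable \<mu> (\<lambda>t. norm (power_series c (circle_pt r t)) powr p)" if "p \<ge> 0"
    by (rule integrable_const_bound[where B = "B powr p"]) (use B that in \<open>auto intro!: powr_mono2\<close>)
qed

text \<open>T may depend on \<delta> but not on r. Since the integral tends to 0, the first term
  disappears in the limit for each fixed T, which leaves room for a truncation level chosen from
  \<delta>.\<close>

lemma abel_sum_tendsto_0_criterion:
  assumes c: "conv_radius c \<ge> 1"
    and T: "\<And>\<delta>. \<delta> > 0 \<Longrightarrow> \<exists>T. \<forall>r\<in>{0<..<1}. (norm (\<Sum>n. abel_term \<alpha> \<phi> c r n))\<^sup>2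
        \<le> T * (\<integral>t. (norm (1 / mu_plus \<mu> (circle_pt r t)))\<^sup>2 \<partial>\<mu>) + \<delta>"
  shows "((\<lambda>r. \<Sum>n. abel_term \<alpha> \<phi> c r n) \<longlongrightarrow> 0) (at_left 1)"
proof -
  have "((\<lambda>r. (norm (\<Sum>n. abel_term \<alpha> \<phi> c r n))\<^sup>2) \<longlongrightarrow> 0) (at_left 1)"
  proof (rule tendstoI)
    fix e :: real assume e: "e > 0"
    obtain T where T: "\<And>r. r \<in> {0<..<1} \<Longrightarrow> (norm (\<Sum>n. abel_term \<alpha> \<phi> c r n))\<^sup>2
        \<le> T * (\<integral>t. (norm (1 / mu_plus \<mu> (circle_pt r t)))\<^sup>2 \<partial>\<mu>) + e / 2"
      using T[of "e / 2"] e by (metis half_gt_zero)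
    have "((\<lambda>r. T * (\<integral>t. (norm (1 / mu_plus \<mu> (circle_pt r t)))\<^sup>2 \<partial>\<mu>)) \<longlongrightarrow> T * 0) (at_left 1)"
      by (intro tendsto_intros integral_inverse_mu_plus_tendsto_0)
    then have "\<forall>\<^sub>F r in at_left 1. dist (T * (\<integral>t. (norm (1 / mu_plus \<mu> (circle_pt r t)))\<^sup>2 \<partial>\<mu>)) 0 < e / 2"
      using e by (intro tendstoD) auto
    moreover have "\<forall>\<^sub>F r in at_left (1::real). r \<in> {0<..<1}"
      by (rule eventually_at_leftI[of 0]) auto
    ultimately show "\<forall>\<^sub>F r in at_left 1. dist ((norm (\<Sum>n. abel_term \<alpha> \<phi> c r n))\<^sup>2) 0 < e"
    proof eventually_elim
      case (elim r)
      then show ?case using T[OF elim(2)] by (simp add: dist_real_def)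
    qed
  qed
  then have "((\<lambda>r. sqrt ((norm (\<Sum>n. abel_term \<alpha> \<phi> c r n))\<^sup>2)) \<longlongrightarrow> sqrt 0) (at_left 1)"
    by (rule tendsto_real_sqrt)
  then show ?thesis by (simp add: tendsto_norm_zero_iff)
qed

text \<open>\<open>T = C\<^sup>2\<close> serves for all \<delta>. Asking for the bound only almost
  everywhere covers the essential supremum of the radial maximal function as well as bounded
  analytic functions.\<close>

lemma abel_sum_tendsto_0_bounded:
  assumes c: "conv_radius c \<ge> 1"
    and C: "AE t in \<mu>. \<forall>r\<in>{0<..<1}. norm (power_series c (circle_pt r t)) \<le> C"
  shows "((\<lambda>r. \<Sum>n. abel_term \<alpha> \<phi> c r n) \<longlongrightarrow> 0) (at_left 1)"
proof (rule abel_sum_tendsto_0_criterion[OF c])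
  fix \<delta> :: real assume \<delta>: "\<delta> > 0"
  have "(norm (\<Sum>n. abel_term \<alpha> \<phi> c r n))\<^sup>2
      \<le> C\<^sup>2 * (\<integral>t. (norm (1 / mu_plus \<mu> (circle_pt r t)))\<^sup>2 \<partial>\<mu>) + \<delta>" if r: "r \<in> {0<..<1}" for r
  proof -
    have r': "0 \<le> r" "r < 1" using r by auto
    have "(norm (\<Sum>n. abel_term \<alpha> \<phi> c r n))\<^sup>2
        \<le> (\<integral>t. (norm (1 / mu_plus \<mu> (circle_pt r t)))\<^sup>2 * C\<^sup>2 \<partial>\<mu>)"
      unfolding norm_abel_sum[OF c r']
    proof (rule integral_mono_AE)
      show "AE t in \<mu>. (norm (1 / mu_plus \<mu> (circle_pt r t)))\<^sup>2 * (norm (power_series c (circle_pt r t)))\<^sup>2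
          \<le> (norm (1 / mu_plus \<mu> (circle_pt r t)))\<^sup>2 * C\<^sup>2"
        using C by eventually_elim (use r in \<open>auto intro!: mult_left_mono power_mono\<close>)
    qed (intro integrable_mult_left integrable_weighted[OF c r'])+
    then show ?thesis using \<delta> by (simp add: mult.commute)
  qed
  then show "\<exists>T. \<forall>r\<in>{0<..<1}. (norm (\<Sum>n. abel_term \<alpha> \<phi> c r n))\<^sup>2
      \<le> T * (\<integral>t. (norm (1 / mu_plus \<mu> (circle_pt r t)))\<^sup>2 \<partial>\<mu>) + \<delta>" by blast
qed

text \<open>A uniform moment of order above 2 makes the squares uniformly integrable: values up to R
  fall under the bounded case, and larger ones contribute little, uniformly in r.\<close>

lemma abel_sum_tendsto_0_powr:
  assumes c: "conv_radius c \<ge> 1" and q: "q > 1"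
    and C: "\<And>r. r \<in> {0<..<1} \<Longrightarrow> (\<integral>t. norm (power_series c (circle_pt r t)) powr (2 * q) \<partial>\<mu>) \<le> C"
  shows "((\<lambda>r. \<Sum>n. abel_term \<alpha> \<phi> c r n) \<longlongrightarrow> 0) (at_left 1)"
proof (rule abel_sum_tendsto_0_criterion[OF c])
  fix \<delta> :: real assume \<delta>: "\<delta> > 0"
  \<comment> \<open>The exponent is negative since \<open>q > 1\<close>, so some level R makes the
    large values contribute less than \<delta>. The 4 bounds the squared modulus of
    \<open>1 / mu_plus\<close>.\<close>
  have "((\<lambda>R. R powr (2 - 2 * q)) \<longlongrightarrow> 0) at_top"
    using q by (intro tendsto_neg_powr filterlim_ident) auto
  then have "((\<lambda>R. 4 * C * R powr (2 - 2 * q)) \<longlongrightarrow> 4 * C * 0) at_top"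
    by (intro tendsto_intros)
  then have "\<forall>\<^sub>F R in at_top. dist (4 * C * R powr (2 - 2 * q)) 0 < \<delta>"
    using \<delta> by (intro tendstoD) auto
  then have "\<forall>\<^sub>F R in at_top. dist (4 * C * R powr (2 - 2 * q)) 0 < \<delta> \<and> R > 0"
    using eventually_gt_at_top[of 0] by eventually_elim auto
  then obtain R where R: "R > 0" "4 * C * R powr (2 - 2 * q) < \<delta>"
    by (auto simp: dist_real_def dest!: eventually_happens)
  have "(norm (\<Sum>n. abel_term \<alpha> \<phi> c r n))\<^sup>2
      \<le> R\<^sup>2 * (\<integral>t. (norm (1 / mu_plus \<mu> (circle_pt r t)))\<^sup>2 \<partial>\<mu>) + \<delta>" if r: "r \<in> {0<..<1}" for r
  proof -
    have r': "0 \<le> r" "r < 1" using r by auto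
    let ?s = "\<lambda>t. (norm (1 / mu_plus \<mu> (circle_pt r t)))\<^sup>2"
    let ?v = "\<lambda>t. norm (power_series c (circle_pt r t))"
    note int = integrable_weighted[OF c r']
    have pt: "?s t * (?v t)\<^sup>2 \<le> R\<^sup>2 * ?s t + 4 * R powr (2 - 2 * q) * ?v t powr (2 * q)" for t
    proof (cases "?v t \<le> R")
      case True
      then have "?s t * (?v t)\<^sup>2 \<le> ?s t * R\<^sup>2" by (intro mult_left_mono power_mono) auto
      moreover have "0 \<le> 4 * R powr (2 - 2 * q) * ?v t powr (2 * q)" by simp
      ultimately show ?thesis unfolding mult.commute[of "R\<^sup>2"] by linarith
    next
      case False
      then have v: "?v t > 0" using R by linarith
      \<comment> \<open>Above the level R the surplus power \<open>2 - 2 * q\<close> is negative,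
        hence largest at R itself.\<close>
      have "(?v t)\<^sup>2 = ?v t powr (2 - 2 * q) * ?v t powr (2 * q)"
        using v by (simp add: powr_add[symmetric])
      also have "\<dots> \<le> R powr (2 - 2 * q) * ?v t powr (2 * q)"
        using False R q by (intro mult_right_mono powr_mono2') auto
      finally have "?s t * (?v t)\<^sup>2 \<le> 2\<^sup>2 * (R powr (2 - 2 * q) * ?v t powr (2 * q))"
        using r' by (intro mult_mono power_mono norm_inverse_mu_plus_le) auto
      moreover have "0 \<le> R\<^sup>2 * ?s t" by (intro mult_nonneg_nonneg) auto
      ultimately show ?thesis by (intro add_increasing) (simp_all add: mult.assoc)
    qed
    have "(norm (\<Sum>n. abel_term \<alpha> \<phi> c r n))\<^sup>2
        \<le> (\<integral>t. R\<^sup>2 * ?s t + 4 * R powr (2 - 2 * q) * ?v t powr (2 * q) \<partial>\<mu>)"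
      unfolding norm_abel_sum[OF c r']
      using q by (intro integral_mono Bochner_Integration.integrable_add integrable_mult_right int pt) auto
    also have "\<dots> = R\<^sup>2 * (\<integral>t. ?s t \<partial>\<mu>) + 4 * R powr (2 - 2 * q) * (\<integral>t. ?v t powr (2 * q) \<partial>\<mu>)"
      using int(2) int(3)[of "2 * q"] q
      by (subst Bochner_Integration.integral_add) (auto intro!: integrable_mult_right)
    also have "4 * R powr (2 - 2 * q) * (\<integral>t. ?v t powr (2 * q) \<partial>\<mu>) \<le> 4 * R powr (2 - 2 * q) * C"
      by (intro mult_left_mono C r) auto
    finally show ?thesis using R(2) by (simp add: mult_ac)
  qed
  then show "\<exists>T. \<forall>r\<in>{0<..<1}. (norm (\<Sum>n. abel_term \<alpha> \<phi> c r n))\<^sup>2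
      \<le> T * (\<integral>t. (norm (1 / mu_plus \<mu> (circle_pt r t)))\<^sup>2 \<partial>\<mu>) + \<delta>" by blast
qed

lemma abel_sum_tendsto_0:
  assumes c: "conv_radius c \<ge> 1"
    and "power_series c \<in> H_infinity
       \<or> radial_max c \<in> L_infinity \<mu>
       \<or> (\<exists>q>1. (SUP r\<in>{0<..<1}.
             \<integral>\<^sup>+t. ennreal (norm (power_series c (circle_pt r t)) powr (2 * q)) \<partial>\<mu>) < \<infinity>)"
  shows "((\<lambda>r. \<Sum>n. abel_term \<alpha> \<phi> c r n) \<longlongrightarrow> 0) (at_left 1)"
  using assms(2)
proof (elim disjE exE conjE)
  assume "power_series c \<in> H_infinity"
  then obtain C where C: "\<And>z. norm z < 1 \<Longrightarrow> norm (power_series c z) \<le> C"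
    by (force simp: H_infinity_def bounded_iff)
  show ?thesis
    by (rule abel_sum_tendsto_0_bounded[OF c, of C]) (auto intro!: C)
next
  assume "radial_max c \<in> L_infinity \<mu>"
  \<comment> \<open>A finite essential supremum bounds the maximal function almost everywhere, with
    one exceptional set for all radii at once.\<close>
  then obtain C where C: "esssup \<mu> (radial_max c) = ennreal C" "C \<ge> 0"
    by (cases "esssup \<mu> (radial_max c)") (auto simp: L_infinity_def)
  show ?thesis
  proof (rule abel_sum_tendsto_0_bounded[OF c, of C])
    show "AE t in \<mu>. \<forall>r\<in>{0<..<1}. norm (power_series c (circle_pt r t)) \<le> C"
      using esssup_AE[of "radial_max c" \<mu>]
    proof eventually_elim
      case (elim t)
      have "ennreal (norm (power_series c (circle_pt r t))) \<le> ennreal C" if "r \<in> {0<..<1}" for r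
      proof -
        have "ennreal (norm (power_series c (circle_pt r t))) \<le> radial_max c t"
          unfolding radial_max_def using that by (intro SUP_upper) auto
        then show ?thesis using elim unfolding C(1) by (rule order_trans)
      qed
      then show ?case using C(2) by (simp add: ennreal_le_iff)
    qed
  qed
next
  fix q :: real assume q: "1 < q"
  let ?I = "\<lambda>r. \<integral>\<^sup>+t. ennreal (norm (power_series c (circle_pt r t)) powr (2 * q)) \<partial>\<mu>"
  define S where "S = (SUP r\<in>{0<..<1}. ?I r)"
  assume "(SUP r\<in>{0<..<1}. ?I r) < \<infinity>"
  then obtain C where C: "S = ennreal C" "C \<ge> 0"
    unfolding S_def[symmetric] by (cases S) auto
  show ?thesis
  proof (rule abel_sum_tendsto_0_powr[OF c q, of C])
    fix r :: real assume r: "r \<in> {0<..<1}"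
    have "?I r \<le> ennreal C" unfolding C(1)[symmetric] S_def using r by (rule SUP_upper)
    moreover have "?I r = ennreal (\<integral>t. norm (power_series c (circle_pt r t)) powr (2 * q) \<partial>\<mu>)"
      using r q by (intro nn_integral_eq_integral integrable_weighted[OF c]) auto
    ultimately show "(\<integral>t. norm (power_series c (circle_pt r t)) powr (2 * q) \<partial>\<mu>) \<le> C"
      using C(2) by (simp add: ennreal_le_iff)
  qed
qed

section \<open>Abel reconstruction of a vector from its inner products\<close>

lemma conv_radius_cinner: "conv_radius (\<lambda>j. cinner x (\<phi> j)) \<ge> 1"
proof (rule conv_radius_ge_1I)
  fix z :: complex assume z: "norm z < 1"
  show "summable (\<lambda>n. cinner x (\<phi> n) * z ^ n)"
  proof (rule summable_comparison_test'[of "\<lambda>n. norm x * norm z ^ n" 0])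
    show "summable (\<lambda>n. norm x * norm z ^ n)"
      using z by (intro summable_mult summable_geometric) simp
    show "norm (cinner x (\<phi> n) * z ^ n) \<le> norm x * norm z ^ n" for n
      by (simp add: norm_mult norm_power norm_cinner_unit_le norm_\<phi> mult_right_mono)
  qed
qed

definition synth :: "real \<Rightarrow> 'a \<Rightarrow> 'a" where
  "synth r x = (\<Sum>n. abel_term \<alpha> \<phi> (\<lambda>j. cinner x (\<phi> j)) r n)"

text \<open>The difference is x after projecting off \<open>\<phi> 0\<close>, ...,
  \<open>\<phi> (n - 1)\<close> in turn: by the recursion, \<open>coeff_conv\<close> at n is the
  component of the current residual along \<open>\<phi> n\<close>.\<close>

lemma kaczmarz_residual_le:
  "norm (x - (\<Sum>k<n. coeff_conv (\<lambda>j. cinner x (\<phi> j)) k *\<^sub>C \<phi> k)) \<le> norm x"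
proof (rule power2_le_imp_le)
  define c where "c j = cinner x (\<phi> j)" for j
  define Y where "Y n = x - (\<Sum>k<n. coeff_conv c k *\<^sub>C \<phi> k)" for n
  have ip: "cinner (Y n) (\<phi> n) = coeff_conv c n" for n
    using sum_coeff_conv_gram[of c n] cinner_self[of "\<phi> n"]
    by (simp add: Y_def cinner_diff_left cinner_sum_left cinner_scaleC_left norm_\<phi> c_def[symmetric]
        lessThan_Suc_atMost[symmetric] algebra_simps)
  have "(norm (Y n))\<^sup>2 + (\<Sum>k<n. (norm (cinner (Y k) (\<phi> k)))\<^sup>2) = (norm (Y 0))\<^sup>2"
    by (rule residual_iteration_norm[OF norm_\<phi>]) (simp add: ip, simp add: Y_def)
  moreover have "0 \<le> (\<Sum>k<n. (norm (cinner (Y k) (\<phi> k)))\<^sup>2)" by (rule sum_nonneg) simp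
  ultimately have "(norm (Y n))\<^sup>2 \<le> (norm (Y 0))\<^sup>2" by linarith
  then show "(norm (x - (\<Sum>k<n. coeff_conv (\<lambda>j. cinner x (\<phi> j)) k *\<^sub>C \<phi> k)))\<^sup>2 \<le> (norm x)\<^sup>2"
    unfolding Y_def c_def by simp
qed simp

text \<open>The partial sums differ from x by at most \<open>norm x\<close>, and averaging does not
  increase the bound. A bound uniform in r is what reduces convergence to a dense set.\<close>

lemma norm_synth_le:
  assumes r: "0 \<le> r" "r < 1"
  shows "norm (synth r x) \<le> 2 * norm x"
proof -
  let ?a = "coeff_conv (\<lambda>j. cinner x (\<phi> j))"
  have bd: "norm (\<Sum>k\<le>n. ?a k *\<^sub>C \<phi> k) \<le> 2 * norm x" for n
    using kaczmarz_residual_le[of x "Suc n"] norm_triangle_ineq2[of "\<Sum>k\<le>n. ?a k *\<^sub>C \<phi> k" x]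
    by (simp add: lessThan_Suc_atMost norm_minus_commute)
  have "synth r x = (1 - r) *\<^sub>R (\<Sum>n. r ^ n *\<^sub>R (\<Sum>k\<le>n. ?a k *\<^sub>C \<phi> k))"
    unfolding synth_def abel_term_eq_scaleR using abel_sum_by_parts[OF bd r] by (simp add: sums_iff)
  then show ?thesis
    using abel_mean_norm_bounded[OF bd r] by simp
qed

lemma synth_add: "0 \<le> r \<Longrightarrow> r < 1 \<Longrightarrow> synth r (x + y) = synth r x + synth r y"
  unfolding synth_def cinner_add_left abel_term_add
  by (intro suminf_add[symmetric] summable_abel_term conv_radius_cinner)

lemma synth_scaleC: "0 \<le> r \<Longrightarrow> r < 1 \<Longrightarrow> synth r (a *\<^sub>C x) = a *\<^sub>C synth r x"
  unfolding synth_def cinner_scaleC_left abel_term_scale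
  using bounded_linear.sums[OF bounded_linear_scaleC summable_sums[OF summable_abel_term[OF conv_radius_cinner]], of r a x]
  by (simp add: sums_iff)

text \<open>The inner products from index m on are the coefficients of
  \<open>fps_X ^ m * gram_fps\<close>, which multiplication by \<open>coeff_fps\<close> turns into
  \<open>fps_X ^ m\<close>. The remaining d gives a polynomial, bounded on the closed disc.\<close>

lemma synth_\<phi>_tendsto: "((\<lambda>r. synth r (\<phi> m)) \<longlongrightarrow> \<phi> m) (at_left 1)"
proof -
  define d where "d j = (if j < m then cinner (\<phi> m) (\<phi> j) else 0)" for j
  define s where "s = fps_nth (fps_X ^ m * gram_fps)"
  have split: "cinner (\<phi> m) (\<phi> j) = d j + s j" for j
    by (simp add: d_def s_def fps_X_power_mult_nth cinner_eq_gram)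
  have "coeff_conv s n = (if n = m then 1 else 0)" for n
  proof -
    have "Abs_fps s = fps_X ^ m * gram_fps" by (rule fps_ext) (simp add: s_def)
    then have "coeff_conv s n = fps_nth (fps_X ^ m * (coeff_fps * gram_fps)) n"
      by (simp only: coeff_conv_eq_fps mult_ac)
    then show ?thesis by (simp add: coeff_times_gram fps_X_power_nth)
  qed
  then have s_sums: "abel_term \<alpha> \<phi> s r sums (r ^ m *\<^sub>R \<phi> m)" for r
    using sums_single[of m "\<lambda>n. r ^ n *\<^sub>R \<phi> n"]
    by (simp add: abel_term_eq_scaleR[abs_def] if_distrib[of "\<lambda>a. a *\<^sub>C _"]
        if_distrib[of "\<lambda>v. _ *\<^sub>R v"] cong: if_cong)
  have d: "conv_radius d \<ge> 1"
    by (rule conv_radius_ge_1I) (rule summable_finite[of "{..<m}"], auto simp: d_def)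
  have d_bd: "norm (power_series d z) \<le> (\<Sum>j<m. norm (d j))" if "norm z \<le> 1" for z
  proof -
    have "power_series d z = (\<Sum>j<m. d j * z ^ j)"
      unfolding power_series_def by (rule suminf_finite) (auto simp: d_def)
    also have "norm \<dots> \<le> (\<Sum>j<m. norm (d j * z ^ j))" by (rule norm_sum)
    also have "\<dots> \<le> (\<Sum>j<m. norm (d j))"
      using that by (intro sum_mono) (simp add: norm_mult norm_power mult_left_le power_le_one)
    finally show ?thesis .
  qed
  have "((\<lambda>r. \<Sum>n. abel_term \<alpha> \<phi> d r n) \<longlongrightarrow> 0) (at_left 1)"
    by (rule abel_sum_tendsto_0_bounded[OF d]) (auto intro!: AE_I2 d_bd)
  then have "((\<lambda>r. (\<Sum>n. abel_term \<alpha> \<phi> d r n) + r ^ m *\<^sub>R \<phi> m) \<longlongrightarrow> 0 + 1 ^ m *\<^sub>R \<phi> m) (at_left 1)"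
    by (intro tendsto_intros)
  moreover have "\<forall>\<^sub>F r in at_left (1::real). r \<in> {0<..<1}"
    by (rule eventually_at_leftI[of 0]) auto
  then have "\<forall>\<^sub>F r in at_left 1. (\<Sum>n. abel_term \<alpha> \<phi> d r n) + r ^ m *\<^sub>R \<phi> m = synth r (\<phi> m)"
  proof eventually_elim
    case (elim r)
    have "synth r (\<phi> m) = (\<Sum>n. abel_term \<alpha> \<phi> d r n + abel_term \<alpha> \<phi> s r n)"
      unfolding synth_def split abel_term_add ..
    also have "\<dots> = (\<Sum>n. abel_term \<alpha> \<phi> d r n) + (\<Sum>n. abel_term \<alpha> \<phi> s r n)"
      using elim by (intro suminf_add[OF summable_abel_term[OF d] sums_summable[OF s_sums], symmetric]) auto
    finally show ?case using s_sums[of r] by (simp add: sums_iff)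
  qed
  ultimately have "((\<lambda>r. synth r (\<phi> m)) \<longlongrightarrow> 0 + 1 ^ m *\<^sub>R \<phi> m) (at_left 1)"
    by (rule Lim_transform_eventually)
  then show ?thesis by simp
qed

lemma synth_tendsto:
  assumes "linearly_dense \<phi>"
  shows "((\<lambda>r. synth r x) \<longlongrightarrow> x) (at_left 1)"
proof (rule tendstoI)
  fix e :: real assume e: "e > 0"
  have ev: "\<forall>\<^sub>F r in at_left (1::real). r \<in> {0<..<1}"
    by (rule eventually_at_leftI[of 0]) auto
  have span: "((\<lambda>r. synth r y) \<longlongrightarrow> y) (at_left 1)" if "y \<in> cspan (range \<phi>)" for y
    using that
  proof (induction rule: complex_vector.span_induct)
    case base
    show ?case
    \<comment> \<open>The vectors that are recovered form a subspace. Linearity of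
      \<open>synth r\<close> is available for r in [0,1), so the identities are stated
      eventually.\<close>
    proof (rule complex_vector.subspaceI)
      have "synth r 0 = 0" for r
        unfolding synth_def by (simp add: abel_term_def[abs_def])
      then show "0 \<in> {y. ((\<lambda>r. synth r y) \<longlongrightarrow> y) (at_left 1)}" by simp
    next
      fix y z assume *: "y \<in> {y. ((\<lambda>r. synth r y) \<longlongrightarrow> y) (at_left 1)}"
        "z \<in> {y. ((\<lambda>r. synth r y) \<longlongrightarrow> y) (at_left 1)}"
      have "((\<lambda>r. synth r y + synth r z) \<longlongrightarrow> y + z) (at_left 1)"
        using * by (intro tendsto_intros) auto
      moreover have "\<forall>\<^sub>F r in at_left 1. synth r y + synth r z = synth r (y + z)"
        using ev by eventually_elim (simp add: synth_add)
      ultimately have "((\<lambda>r. synth r (y + z)) \<longlongrightarrow> y + z) (at_left 1)"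
        by (rule Lim_transform_eventually)
      then show "y + z \<in> {y. ((\<lambda>r. synth r y) \<longlongrightarrow> y) (at_left 1)}" by simp
    next
      fix a y assume *: "y \<in> {y. ((\<lambda>r. synth r y) \<longlongrightarrow> y) (at_left 1)}"
      have "((\<lambda>r. a *\<^sub>C synth r y) \<longlongrightarrow> a *\<^sub>C y) (at_left 1)"
        using * by (intro bounded_linear.tendsto[OF bounded_linear_scaleC]) simp
      moreover have "\<forall>\<^sub>F r in at_left 1. a *\<^sub>C synth r y = synth r (a *\<^sub>C y)"
        using ev by eventually_elim (simp add: synth_scaleC)
      ultimately have "((\<lambda>r. synth r (a *\<^sub>C y)) \<longlongrightarrow> a *\<^sub>C y) (at_left 1)"
        by (rule Lim_transform_eventually)
      then show "a *\<^sub>C y \<in> {y. ((\<lambda>r. synth r y) \<longlongrightarrow> y) (at_left 1)}" by simp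
    qed
  next
    case (step y)
    then show ?case using synth_\<phi>_tendsto by auto
  qed
  have "x \<in> closure (cspan (range \<phi>))"
    using assms by (simp add: linearly_dense_def)
  \<comment> \<open>Replacing x by y costs \<open>2 * norm (x - y)\<close> inside
    \<open>synth\<close> and \<open>norm (y - x)\<close> outside, so \<open>e / 6\<close> keeps the
    total below \<open>e / 2\<close>.\<close>
  then obtain y where y: "y \<in> cspan (range \<phi>)" "dist y x < e / 6"
    using e unfolding closure_approachable by (metis divide_pos_pos zero_less_numeral)
  have "\<forall>\<^sub>F r in at_left 1. dist (synth r y) y < e / 2"
    using span[OF y(1)] e by (intro tendstoD) auto
  then show "\<forall>\<^sub>F r in at_left 1. dist (synth r x) x < e"
    using ev
  proof eventually_elim
    case (elim r)
    have "synth r x = synth r (x - y) + synth r y"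
      using synth_add[of r "x - y" y] elim by simp
    then have "synth r x - x = synth r (x - y) + (synth r y - y) + (y - x)" by simp
    also have "norm \<dots> \<le> norm (synth r (x - y)) + norm (synth r y - y) + norm (y - x)"
      using norm_triangle_ineq[of "synth r (x - y) + (synth r y - y)" "y - x"]
        norm_triangle_ineq[of "synth r (x - y)" "synth r y - y"] by linarith
    also have "norm (synth r (x - y)) \<le> 2 * norm (x - y)"
      using elim by (intro norm_synth_le) auto
    finally show ?case
      using y(2) elim(1) by (simp add: dist_norm norm_minus_commute)
  qed
qed

end

theorem theorem4:
  fixes \<phi> :: "nat \<Rightarrow> 'a::complex_hilbert"
    and \<mu> :: "real measure"
    and \<alpha> \<epsilon> :: "nat \<Rightarrow> complex"
    and x :: 'a
  assumes "\<And>n. norm (\<phi> n) = 1"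
    and "stationary \<phi>"
    and "linearly_dense \<phi>"
    and "is_spectral_measure \<phi> \<mu>"
    and "singular_wrt_lebesgue \<mu>"
    and "is_coeff_seq \<mu> \<alpha>"
    and "conv_radius \<epsilon> \<ge> 1"
    and "power_series \<epsilon> \<in> H_infinity
       \<or> radial_max \<epsilon> \<in> L_infinity \<mu>
       \<or> (\<exists>q>1. (SUP r\<in>{0<..<1}.
             \<integral>\<^sup>+t. ennreal (norm (power_series \<epsilon> (circle_pt r t)) powr (2 * q)) \<partial>\<mu>) < \<infinity>)"
  shows "(\<forall>r\<in>{0..<1}. summable (abel_term \<alpha> \<phi> \<epsilon> r)) \<and>
         ((\<lambda>r. norm (\<Sum>n. abel_term \<alpha> \<phi> \<epsilon> r n)) \<longlongrightarrow> 0) (at_left 1) \<and>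
         (\<forall>r\<in>{0..<1}. summable (abel_term \<alpha> \<phi> (\<lambda>j. cinner x (\<phi> j) + \<epsilon> j) r)) \<and>
         ((\<lambda>r. \<Sum>n. abel_term \<alpha> \<phi> (\<lambda>j. cinner x (\<phi> j) + \<epsilon> j) r n) \<longlongrightarrow> x) (at_left 1)"
proof -
  interpret prob_space \<mu> using assms(4) by (simp add: is_spectral_measure_def)
  interpret singular_stationary \<mu> \<phi> \<alpha>
  proof
    show "sets \<mu> = sets (restrict_space borel {0..<1})"
      using assms(4) by (simp add: is_spectral_measure_def)
    show "cinner (\<phi> (n + k)) (\<phi> (m + k)) = cinner (\<phi> n) (\<phi> m)" for n k m
      using assms(2) by (simp add: stationary_def)
    \<comment> \<open>Conjugation inverts points of the unit circle, so this product is the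
      character of frequency \<open>n - m\<close>.\<close>
    have "circle_pt 1 t ^ n * cnj (circle_pt 1 t) ^ m
        = exp (2 * of_real pi * \<i> * (of_nat n - of_nat m) * of_real t)" for n m t
      by (simp add: circle_pt_def exp_cnj exp_of_nat_mult[symmetric] exp_add[symmetric] algebra_simps)
    then show "cinner (\<phi> n) (\<phi> m) = (\<integral>t. circle_pt 1 t ^ n * cnj (circle_pt 1 t) ^ m \<partial>\<mu>)" for n m
      using assms(4) by (simp add: is_spectral_measure_def)
    show "(\<lambda>n. \<alpha> n * z ^ n) sums (1 / mu_plus \<mu> z)" if "norm z < 1" for z
      using assms(6) that by (simp add: is_coeff_seq_def inner_b_def)
  qed (fact assms)+
  note part1 = abel_sum_tendsto_0[OF assms(7,8)]
  have sum\<epsilon>: "summable (abel_term \<alpha> \<phi> \<epsilon> r)" if "r \<in> {0..<1}" for r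
    using that by (intro summable_abel_term assms(7)) auto
  have sumx: "summable (abel_term \<alpha> \<phi> (\<lambda>j. cinner x (\<phi> j)) r)" if "r \<in> {0..<1}" for r
    using that by (intro summable_abel_term conv_radius_cinner) auto
  \<comment> \<open>Abel terms are additive in the coefficients: the perturbed sum is the exact
    synthesis of x plus a vanishing error.\<close>
  have "((\<lambda>r. synth r x + (\<Sum>n. abel_term \<alpha> \<phi> \<epsilon> r n)) \<longlongrightarrow> x + 0) (at_left 1)"
    by (intro tendsto_intros synth_tendsto assms(3) part1)
  moreover have "\<forall>\<^sub>F r in at_left (1::real). r \<in> {0<..<1}"
    by (rule eventually_at_leftI[of 0]) auto
  then have "\<forall>\<^sub>F r in at_left 1. synth r x + (\<Sum>n. abel_term \<alpha> \<phi> \<epsilon> r n)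
      = (\<Sum>n. abel_term \<alpha> \<phi> (\<lambda>j. cinner x (\<phi> j) + \<epsilon> j) r n)"
    by eventually_elim (simp add: synth_def abel_term_add suminf_add sum\<epsilon> sumx)
  ultimately have "((\<lambda>r. \<Sum>n. abel_term \<alpha> \<phi> (\<lambda>j. cinner x (\<phi> j) + \<epsilon> j) r n) \<longlongrightarrow> x + 0) (at_left 1)"
    by (rule Lim_transform_eventually)
  moreover have "summable (abel_term \<alpha> \<phi> (\<lambda>j. cinner x (\<phi> j) + \<epsilon> j) r)" if "r \<in> {0..<1}" for r
    using summable_add[OF sumx[OF that] sum\<epsilon>[OF that]] by (simp add: abel_term_add[symmetric])
  ultimately show ?thesis
    using sum\<epsilon> tendsto_norm_zero[OF part1] by simp
qed

end
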